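(* Let $p\in[1,\infty)$. Then for every $f\in \bigcup_{0<s<1}{\rm B}_{s,p}^\kappa(\mathbb{R}^n)$, $$\lim_{s\to0^+}s\,{\rm N}^\kappa_{s,p}(f)^p=\frac{4}{p}\|f\|_{{\rm L}^p(\mu_\kappa)}^p.$$
   Context: Dunkl setting on $\mathbb{R}^n$ (standard inner product $\langle\cdot,\cdot\rangle$, norm $|\cdot|$). For $\alpha\neq0$, $r_\alpha x=x-2\frac{\langle\alpha,x\rangle}{|\alpha|^2}\alpha$. A root system $\mathcal{R}$ is a finite nonempty subset of $\mathbb{R}^n\setminus\{0\}$ with $\mathcal{R}\cap\alpha\mathbb{R}=\{\pm\alpha\}$ and $r_\alpha(\mathcal{R})=\mathcal{R}$ for all $\alpha\in\mathcal{R}$, normalized so that $|\alpha|=\sqrt2$; $G$ is the finite reflection group generated by $\{r_\alpha\}$; $\mathcal{R}_+$ is a positive subsystem; $\kappa:\mathcal{R}\to[0,\infty)$ is a $G$-invariant multiplicity function. The Dunkl Laplacian is $\Delta_\kappa f(x)=\Delta f(x)+2\sum_{\alpha\in\mathcal{R}_+}\kappa(\alpha)\big(\frac{\langle\alpha,\nabla f(x)\rangle}{\langle\alpha,x\rangle}-\frac{f(x)-f(r_\alpha x)}{\langle\alpha,x\rangle^2}\big)$. Let $w_\kappa(x)=\prod_{\alpha\in\mathcal{R}_+}|\langle\alpha,x\rangle|^{2\kappa(\alpha)}$, $\mu_\kappa=w_\kappa\,dx$, and ${\rm L}^p(\mu_\kappa)$ the usual Lebesgue space. $(P^\kappa_t)_{t\ge0}$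 is the Dunkl heat semigroup generated by $\Delta_\kappa$ (self-adjoint on ${\rm L}^2(\mu_\kappa)$), given by $P_t^\kappa f(x)=\int f(y)p_t^\kappa(x,y)\,\mu_\kappa(dy)$ with the (positive, smooth, symmetric, conservative) Dunkl heat kernel $p_t^\kappa$. For $p\in[1,\infty)$, $s>0$, the Besov seminorm is $${\rm N}^\kappa_{s,p}(f)=\Big(\int_0^\infty t^{-(1+\frac{sp}{2})}\int_{\mathbb{R}^n}P_t^\kappa(|f-f(x)|^p)(x)\,\mu_\kappa(dx)\,dt\Big)^{1/p},$$ where $P_t^\kappa(|f-f(x)|^p)(x)=\int |f(y)-f(x)|^p p_t^\kappa(x,y)\mu_\kappa(dy)$, and ${\rm B}^\kappa_{s,p}(\mathbb{R}^n)=\{f\in{\rm L}^p(\mu_\kappa):{\rm N}^\kappa_{s,p}(f)<\infty\}$. *)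

theory Defs
  imports "HOL-Analysis.Analysis"
begin

definition reflection :: "'a::euclidean_space \<Rightarrow> 'a \<Rightarrow> 'a" where
  "reflection \<alpha> x = x - (2 * (\<alpha> \<bullet> x) / (\<alpha> \<bullet> \<alpha>)) *\<^sub>R \<alpha>"

definition root_system :: "'a::euclidean_space set \<Rightarrow> bool" where
  "root_system R \<longleftrightarrow> finite R \<and> R \<noteq> {} \<and> 0 \<notin> R \<and>
     (\<forall>\<alpha>\<in>R. R \<inter> {c *\<^sub>R \<alpha> | c. True} = {\<alpha>, - \<alpha>}) \<and>
     (\<forall>\<alpha>\<in>R. reflection \<alpha> ` R = R) \<and>
     (\<forall>\<alpha>\<in>R. norm \<alpha> = sqrt 2)"

definition positive_subsystem :: "'a::euclidean_space set \<Rightarrow> 'a set \<Rightarrow> bool" where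
  "positive_subsystem R Rp \<longleftrightarrow>
     (\<exists>\<beta>. (\<forall>\<alpha>\<in>R. \<beta> \<bullet> \<alpha> \<noteq> 0) \<and> Rp = {\<alpha>\<in>R. \<beta> \<bullet> \<alpha> > 0})"

definition reflection_group :: "'a::euclidean_space set \<Rightarrow> ('a \<Rightarrow> 'a) set" where
  "reflection_group R =
     {g. \<exists>rs. set rs \<subseteq> R \<and> g = fold (\<lambda>\<alpha> h. reflection \<alpha> \<circ> h) rs id}"

definition multiplicity_function :: "'a::euclidean_space set \<Rightarrow> ('a \<Rightarrow> real) \<Rightarrow> bool" where
  "multiplicity_function R \<kappa> \<longleftrightarrow>
     (\<forall>\<alpha>\<in>R. 0 \<le> \<kappa> \<alpha>) \<and> (\<forall>g\<in>reflection_group R. \<forall>\<alpha>\<in>R. \<kappa> (g \<alpha>) = \<kappa> \<alpha>)"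

text \<open>Weight w_kappa(x) = prod |<alpha,x>|^(2 kappa(alpha)), with the convention t^0 = 1.\<close>
definition dunkl_weight :: "'a::euclidean_space set \<Rightarrow> ('a \<Rightarrow> real) \<Rightarrow> 'a \<Rightarrow> real" where
  "dunkl_weight Rp \<kappa> x =
     (\<Prod>\<alpha>\<in>Rp. (if \<kappa> \<alpha> = 0 then 1 else \<bar>\<alpha> \<bullet> x\<bar> powr (2 * \<kappa> \<alpha>)))"

definition dunkl_measure :: "'a::euclidean_space set \<Rightarrow> ('a \<Rightarrow> real) \<Rightarrow> 'a measure" where
  "dunkl_measure Rp \<kappa> = density lborel (\<lambda>x. ennreal (dunkl_weight Rp \<kappa> x))"

text \<open>The Dunkl Laplacian (pointwise formula; meaningful off the root hyperplanes).\<close>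
definition dunkl_laplacian ::
  "'a::euclidean_space set \<Rightarrow> ('a \<Rightarrow> real) \<Rightarrow> ('a \<Rightarrow> real) \<Rightarrow> 'a \<Rightarrow> real" where
  "dunkl_laplacian Rp \<kappa> f x =
     (\<Sum>b\<in>Basis. frechet_derivative (\<lambda>y. frechet_derivative f (at y) b) (at x) b)
     + 2 * (\<Sum>\<alpha>\<in>Rp. \<kappa> \<alpha> * (frechet_derivative f (at x) \<alpha> / (\<alpha> \<bullet> x)
                               - (f x - f (reflection \<alpha> x)) / (\<alpha> \<bullet> x)^2))"

definition C2_fun :: "('a::euclidean_space \<Rightarrow> real) \<Rightarrow> bool" where
  "C2_fun f \<longleftrightarrow> (\<forall>x. f differentiable (at x)) \<and>
     (\<forall>b\<in>Basis. \<forall>x. (\<lambda>y. frechet_derivative f (at y) b) differentiable (at x)) \<and>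
     (\<forall>b\<in>Basis. \<forall>c\<in>Basis. continuous_on UNIV
        (\<lambda>y. frechet_derivative (\<lambda>z. frechet_derivative f (at z) b) (at y) c))"

definition dunkl_heat_kernel ::
  "'a::euclidean_space set \<Rightarrow> ('a \<Rightarrow> real) \<Rightarrow> (real \<Rightarrow> 'a \<Rightarrow> 'a \<Rightarrow> real) \<Rightarrow> bool" where
  "dunkl_heat_kernel Rp \<kappa> hk \<longleftrightarrow>
     (\<forall>t>0. \<forall>x y. 0 < hk t x y \<and> hk t x y = hk t y x) \<and>
     continuous_on ({0<..} \<times> UNIV) (\<lambda>(t, x, y). hk t x y) \<and>
     (\<forall>t>0. \<forall>x. (\<integral>\<^sup>+ y. ennreal (hk t x y) \<partial>dunkl_measure Rp \<kappa>) = 1) \<and>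
     (\<forall>f :: 'a \<Rightarrow> real. continuous_on UNIV f \<and> (\<exists>r. \<forall>x. r < norm x \<longrightarrow> f x = 0) \<longrightarrow>
        (let u = (\<lambda>t x. \<integral> y. f y * hk t x y \<partial>dunkl_measure Rp \<kappa>) in
          uniform_limit UNIV u f (at_right 0) \<and>
          (\<forall>t>0. C2_fun (u t)) \<and>
          (\<forall>t>0. \<forall>x. (\<forall>\<alpha>\<in>Rp. \<alpha> \<bullet> x \<noteq> 0) \<longrightarrow>
             ((\<lambda>\<tau>. u \<tau> x) has_real_derivative dunkl_laplacian Rp \<kappa> (u t) x) (at t))))"

definition besov_Np ::
  "'a::euclidean_space set \<Rightarrow> ('a \<Rightarrow> real) \<Rightarrow> (real \<Rightarrow> 'a \<Rightarrow> 'a \<Rightarrow> real)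
     \<Rightarrow> real \<Rightarrow> real \<Rightarrow> ('a \<Rightarrow> real) \<Rightarrow> ennreal" where
  "besov_Np Rp \<kappa> hk p s f =
     (\<integral>\<^sup>+ t\<in>{0<..}. ennreal (t powr (- (1 + s * p / 2))) *
        (\<integral>\<^sup>+ x. (\<integral>\<^sup>+ y. ennreal (\<bar>f y - f x\<bar> powr p * hk t x y) \<partial>dunkl_measure Rp \<kappa>)
           \<partial>dunkl_measure Rp \<kappa>) \<partial>lborel)"

definition in_Lp :: "'a measure \<Rightarrow> real \<Rightarrow> ('a \<Rightarrow> real) \<Rightarrow> bool" where
  "in_Lp M p f \<longleftrightarrow> f \<in> borel_measurable M \<and> integrable M (\<lambda>x. \<bar>f x\<bar> powr p)"

definition besov_space ::
  "'a::euclidean_space set \<Rightarrow> ('a \<Rightarrow> real) \<Rightarrow> (real \<Rightarrow> 'a \<Rightarrow> 'a \<Rightarrow> real)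
     \<Rightarrow> real \<Rightarrow> real \<Rightarrow> ('a \<Rightarrow> real) set" where
  "besov_space Rp \<kappa> hk s p =
     {f. in_Lp (dunkl_measure Rp \<kappa>) p f \<and> besov_Np Rp \<kappa> hk p s f < \<infinity>}"

end

theory Submission
  imports Defs
begin

text \<open>
  Write \<open>A(t)\<close> for the double integral of \<open>\<bar>f y - f x\<bar>\<^sup>p p\<^sub>t(x, y)\<close>. The part of the Besov integral over
  bounded times stays finite as \<open>s \<rightarrow> 0\<close> and is killed by the factor \<open>s\<close>, so the limit is
  \<open>2 / p\<close> times the limit of \<open>A\<close> at infinity. Up to a small error, \<open>\<bar>f y - f x\<bar>\<^sup>p\<close> differs from
  \<open>\<bar>f x\<bar>\<^sup>p + \<bar>f y\<bar>\<^sup>p\<close> by a multiple of their minimum, whose integral against \<open>p\<^sub>t\<close> vanishes as soon as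
  the heat semigroup applied to the indicator of a ball tends to zero uniformly; then
  symmetry and conservativeness give \<open>A(t) \<rightarrow> 2 \<parallel>f\<parallel>\<^sup>p\<close>.

  The decay follows from comparison with the explicit radial solution
  \<open>(1 + t) powr (-N) * exp (-\<bar>x\<bar>\<^sup>2 / (4 (1 + t)))\<close>, \<open>N = n / 2 + \<Sum> \<kappa>\<close>, by a maximum principle.
  The heat equation is only available off the reflection hyperplanes; adding a small multiple of
  the convex function \<open>\<Sum> \<bar>\<alpha> \<bullet> x\<bar>\<close> keeps the maximum away from them, since its kink cannot be
  compensated by a differentiable function, while its supporting linear functions are Dunkl harmonic.
\<close>

lemma abs_diff_powr_bound:
  fixes p e :: real
  assumes "0 < p" "0 < e"
  obtains C where "0 \<le> C"
    "\<And>a b :: real. \<bar>\<bar>a - b\<bar> powr p - (\<bar>a\<bar> powr p + \<bar>b\<bar> powr p)\<bar>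
        \<le> e * (\<bar>a\<bar> powr p + \<bar>b\<bar> powr p) + C * min (\<bar>a\<bar> powr p) (\<bar>b\<bar> powr p)"
proof -
  have "isCont (\<lambda>x::real. x powr p) 1" by (auto intro!: continuous_intros)
  then obtain d where d: "d > 0" "\<And>x::real. \<bar>x - 1\<bar> < d \<Longrightarrow> \<bar>x powr p - 1\<bar> < e"
    using \<open>0 < e\<close> unfolding continuous_at_eps_delta dist_real_def by fastforce
  define C where "C = (2 / d) powr p + (1 / d) powr p + 1"
  have small: "\<bar>y - (a + b)\<bar> \<le> u + v + w" if "\<bar>y - a\<bar> \<le> u" "b \<le> w" "0 \<le> b" "0 \<le> v"
    for a b y u v w :: real using that by linarith
  have large: "\<bar>y - (a + b)\<bar> \<le> u + v + (y' + a' + b)"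
    if "y \<le> y'" "a \<le> a'" "0 \<le> y" "0 \<le> a" "0 \<le> b" "0 \<le> u" "0 \<le> v"
    for a b y u v y' a' :: real using that by linarith
  have main: "\<bar>\<bar>a - b\<bar> powr p - (\<bar>a\<bar> powr p + \<bar>b\<bar> powr p)\<bar>
      \<le> e * (\<bar>a\<bar> powr p + \<bar>b\<bar> powr p) + C * \<bar>b\<bar> powr p"
    if "\<bar>b\<bar> \<le> \<bar>a\<bar>" for a b :: real
  proof (cases "a = 0")
    case True then show ?thesis using that by simp
  next
    case False
    have eb: "0 \<le> e * \<bar>b\<bar> powr p" "0 \<le> e * \<bar>a\<bar> powr p" using assms by auto
    show ?thesis
    proof (cases "\<bar>b\<bar> < d * \<bar>a\<bar>")
      case True
      define r y where "r = \<bar>a\<bar>" and "y = \<bar>a - b\<bar>"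
      have r: "0 < r" "0 \<le> y" "\<bar>y - r\<bar> < d * r"
        using True False by (auto simp: r_def y_def)
      have "y / r - 1 = (y - r) / r" using r by (simp add: diff_divide_distrib)
      then have "\<bar>y / r - 1\<bar> < d" using r by (simp add: abs_divide pos_divide_less_eq)
      then have "\<bar>(y / r) powr p - 1\<bar> < e" by (rule d)
      then have "r powr p * \<bar>(y / r) powr p - 1\<bar> \<le> r powr p * e"
        by (intro mult_left_mono) auto
      moreover have "r powr p * \<bar>(y / r) powr p - 1\<bar> = \<bar>r powr p * ((y / r) powr p - 1)\<bar>"
        by (simp add: abs_mult)
      moreover have "r powr p * ((y / r) powr p - 1) = y powr p - r powr p"
        using r by (simp add: powr_divide right_diff_distrib)
      ultimately have "\<bar>\<bar>a - b\<bar> powr p - \<bar>a\<bar> powr p\<bar> \<le> e * \<bar>a\<bar> powr p"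
        by (simp add: r_def y_def mult.commute)
      moreover have "\<bar>b\<bar> powr p \<le> C * \<bar>b\<bar> powr p"
        by (simp add: C_def distrib_right)
      moreover have "0 \<le> \<bar>b\<bar> powr p" by simp
      ultimately show ?thesis using eb unfolding distrib_left by (intro small)
    next
      case nb: False
      have "\<bar>a\<bar> \<le> 1 / d * \<bar>b\<bar>" using nb d(1) by (simp add: field_simps)
      moreover from this that have "\<bar>a - b\<bar> \<le> 2 / d * \<bar>b\<bar>" by simp
      ultimately
      have "\<bar>a\<bar> powr p \<le> (1 / d * \<bar>b\<bar>) powr p" "\<bar>a - b\<bar> powr p \<le> (2 / d * \<bar>b\<bar>) powr p"
        using assms by (auto intro!: powr_mono2 simp del: times_divide_eq_left)
      then have "\<bar>a\<bar> powr p \<le> (1 / d) powr p * \<bar>b\<bar> powr p"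
          "\<bar>a - b\<bar> powr p \<le> (2 / d) powr p * \<bar>b\<bar> powr p"
        using d(1) by (simp_all add: powr_mult powr_divide)
      moreover have "0 \<le> \<bar>a\<bar> powr p" "0 \<le> \<bar>b\<bar> powr p" "0 \<le> \<bar>a - b\<bar> powr p" by auto
      ultimately show ?thesis using eb unfolding C_def distrib_right distrib_left mult_1
        by (intro large)
    qed
  qed
  show thesis
  proof (rule that[of C])
    show "0 \<le> C" by (simp add: C_def)
    fix a b :: real
    show "\<bar>\<bar>a - b\<bar> powr p - (\<bar>a\<bar> powr p + \<bar>b\<bar> powr p)\<bar>
        \<le> e * (\<bar>a\<bar> powr p + \<bar>b\<bar> powr p) + C * min (\<bar>a\<bar> powr p) (\<bar>b\<bar> powr p)"
    proof (cases "\<bar>b\<bar> \<le> \<bar>a\<bar>")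
      case True
      then have "min (\<bar>a\<bar> powr p) (\<bar>b\<bar> powr p) = \<bar>b\<bar> powr p"
        using assms by (simp add: min_def powr_mono2) (meson antisym powr_mono2 abs_ge_zero less_imp_le)
      then show ?thesis using main[OF True] by simp
    next
      case False
      then have "min (\<bar>a\<bar> powr p) (\<bar>b\<bar> powr p) = \<bar>a\<bar> powr p"
        using assms by (simp add: min_def powr_mono2)
      then show ?thesis using main[of a b] main[of b a] False
        by (simp add: abs_minus_commute add.commute)
    qed
  qed
qed

lemma tendsto_ennrealI:
  fixes X :: "'b \<Rightarrow> ennreal" and L :: real
  assumes "0 \<le> L"
    and up: "\<And>e. 0 < e \<Longrightarrow> eventually (\<lambda>s. X s \<le> ennreal (L + e)) F"
    and lo: "\<And>e. 0 < e \<Longrightarrow> eventually (\<lambda>s. ennreal (L - e) \<le> X s) F"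
  shows "(X \<longlongrightarrow> ennreal L) F"
proof (rule order_tendstoI)
  fix a assume "a < ennreal L"
  then obtain r where r: "a = ennreal r" "0 \<le> r" "r < L"
    by (cases a) (auto simp: ennreal_less_iff)
  then have "a < ennreal (L - (L - r) / 2)" by (simp add: ennreal_less_iff field_simps)
  moreover have "0 < (L - r) / 2" using r by simp
  ultimately show "eventually (\<lambda>s. a < X s) F"
    using lo[of "(L - r) / 2"] by (auto elim!: eventually_mono)
next
  fix a assume a: "ennreal L < a"
  obtain e where e: "e > 0" "ennreal (L + e) < a"
  proof (cases a)
    case (real r)
    then show ?thesis using a \<open>0 \<le> L\<close> that[of "(r - L) / 2"] by (auto simp: ennreal_less_iff field_simps)
  next
    case top
    then show ?thesis using that[of 1] by simp
  qed
  show "eventually (\<lambda>s. X s < a) F"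
    using up[OF e(1)] by (rule eventually_mono) (use e(2) in auto)
qed

lemma nn_integral_powr_atLeast:
  fixes q T :: real
  assumes "0 < q" "0 < T"
  shows "(\<integral>\<^sup>+ t. ennreal (t powr (- (1 + q))) * indicator {T..} t \<partial>lborel) = ennreal (T powr (- q) / q)"
proof -
  have "(\<integral>\<^sup>+ t. ennreal (t powr (- (1 + q))) * indicator {T..} t \<partial>lborel) = ennreal (0 - - (T powr (- q) / q))"
  proof (rule nn_integral_FTC_atLeast)
    show "((\<lambda>t. - (t powr (- q) / q)) \<longlongrightarrow> 0) at_top"
      using tendsto_divide[OF tendsto_neg_powr[of "- q" "\<lambda>x. x" at_top] tendsto_const[of q]] assms
      by (auto simp: filterlim_ident intro: tendsto_eq_rhs[OF tendsto_minus])
    have exponent: "- q - 1 = - 1 - q" by simp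
    show "((\<lambda>t. - (t powr (- q) / q)) has_real_derivative t powr (- (1 + q))) (at t)" if "T \<le> t" for t
      using assms that by (auto intro!: derivative_eq_intros simp: exponent)
  qed auto
  then show ?thesis by simp
qed

lemma scaled_mellin_tendsto:
  fixes A :: "real \<Rightarrow> ennreal" and L p s0 :: real
  assumes A[measurable]: "(\<lambda>t. A t * indicator {0<..} t) \<in> borel_measurable borel"
    and p: "0 < p" and s0: "0 < s0" and L: "0 \<le> L"
    and fin: "(\<integral>\<^sup>+ t\<in>{0<..}. ennreal (t powr (- (1 + s0 * p / 2))) * A t \<partial>lborel) < \<infinity>"
    and lim: "(A \<longlongrightarrow> ennreal L) at_top"
  shows "((\<lambda>s. ennreal s * (\<integral>\<^sup>+ t\<in>{0<..}. ennreal (t powr (- (1 + s * p / 2))) * A t \<partial>lborel))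
    \<longlongrightarrow> ennreal (2 / p * L)) (at_right 0)"
proof (rule tendsto_ennrealI)
  let ?N = "\<lambda>s. \<integral>\<^sup>+ t\<in>{0<..}. ennreal (t powr (- (1 + s * p / 2))) * A t \<partial>lborel"
  let ?J = "\<lambda>T s. \<integral>\<^sup>+ t. ennreal (t powr (- (1 + s * p / 2))) * indicator {T..} t \<partial>lborel"
  show "0 \<le> 2 / p * L" using p L by simp
  have J: "?J T s = ennreal (T powr (- (s * p / 2)) * 2 / (s * p))" if "0 < T" "0 < s" for T s
    using nn_integral_powr_atLeast[of "s * p / 2" T] that p by simp
  have sJ: "ennreal s * (ennreal b * ?J T s) = ennreal (b * (2 / p) * T powr (- (s * p / 2)))"
    if "0 < T" "0 < s" "0 \<le> b" for b T s
    unfolding J[OF that(1,2)] using that p by (simp add: field_simps flip: ennreal_mult)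
  have pos: "eventually (\<lambda>s. s \<in> {0<..<s0}) (at_right (0::real))"
    using s0 by (rule eventually_at_right_real)
  {
    fix e :: real assume e: "0 < e"
    have "ennreal L < ennreal (L + e * p / 4)" using e p L by (simp add: ennreal_less_iff)
    from order_tendstoD(2)[OF lim this]
    obtain T0 where T0: "\<And>t. T0 \<le> t \<Longrightarrow> A t < ennreal (L + e * p / 4)"
      unfolding eventually_at_top_linorder by auto
    define T where "T = max T0 1"
    have T: "1 \<le> T" "\<And>t. T \<le> t \<Longrightarrow> A t \<le> ennreal (L + e * p / 4)"
      using T0 by (auto simp: T_def less_imp_le)
    obtain n where n: "?N s0 = ennreal n" "0 \<le> n" using fin by (cases "?N s0") auto
    define K where "K = T powr (s0 * p / 2)"
    have K: "0 \<le> K" by (simp add: K_def)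
    have "((\<lambda>s. s * (K * n)) \<longlongrightarrow> 0 * (K * n)) (at_right 0)" by (intro tendsto_intros)
    then have "eventually (\<lambda>s. s * (K * n) < e / 2) (at_right 0)"
      by (rule order_tendstoD(2)) (use e in simp)
    with pos show "eventually (\<lambda>s. ennreal s * ?N s \<le> ennreal (2 / p * L + e)) (at_right 0)"
    proof eventually_elim
      case (elim s)
      then have s: "0 < s" "s < s0" by auto
      let ?X0 = "\<lambda>t. ennreal (t powr (- (1 + s0 * p / 2))) * (A t * indicator {0<..} t)"
      have "?N s \<le> (\<integral>\<^sup>+ t. ennreal K * ?X0 t
          + ennreal (L + e * p / 4) * (ennreal (t powr (- (1 + s * p / 2))) * indicator {T..} t) \<partial>lborel)"
      proof (intro nn_integral_mono)
        fix t :: real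
        show "ennreal (t powr (- (1 + s * p / 2))) * A t * indicator {0<..} t
          \<le> ennreal K * ?X0 t
          + ennreal (L + e * p / 4) * (ennreal (t powr (- (1 + s * p / 2))) * indicator {T..} t)"
        proof (cases "0 < t")
          case True
          show ?thesis
          proof (cases "T \<le> t")
            case ge: True
            have "ennreal (t powr (- (1 + s * p / 2))) * A t \<le> ennreal (t powr (- (1 + s * p / 2))) * ennreal (L + e * p / 4)"
              by (intro mult_left_mono T(2) ge) auto
            then show ?thesis using ge True by (simp add: mult.commute add_increasing)
          next
            case False
            have "- (1 + s * p / 2) = (s0 - s) * p / 2 + - (1 + s0 * p / 2)" by (simp add: field_simps)
            then have "t powr (- (1 + s * p / 2)) = t powr ((s0 - s) * p / 2) * t powr (- (1 + s0 * p / 2))"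
              by (simp only: powr_add)
            also have "\<dots> \<le> K * t powr (- (1 + s0 * p / 2))"
            proof (intro mult_right_mono)
              have "t powr ((s0 - s) * p / 2) \<le> T powr ((s0 - s) * p / 2)"
                using False True s p by (intro powr_mono2) auto
              also have "\<dots> \<le> K" unfolding K_def using T s p by (intro powr_mono) auto
              finally show "t powr ((s0 - s) * p / 2) \<le> K" .
            qed auto
            finally have "ennreal (t powr (- (1 + s * p / 2))) * A t
                \<le> ennreal (K * t powr (- (1 + s0 * p / 2))) * A t"
              by (intro mult_right_mono ennreal_leI) auto
            then show ?thesis using True False K by (simp add: ennreal_mult mult.assoc)
          qed
        qed auto
      qed
      also have "\<dots> = ennreal K * ?N s0 + ennreal (L + e * p / 4) * ?J T s"
        by (subst nn_integral_add) (simp_all add: nn_integral_cmult mult.assoc)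
      finally have "ennreal s * ?N s \<le> ennreal s * (ennreal K * ?N s0 + ennreal (L + e * p / 4) * ?J T s)"
        by (rule mult_left_mono) auto
      also have "\<dots> = ennreal (s * (K * n)) + ennreal ((L + e * p / 4) * (2 / p) * T powr (- (s * p / 2)))"
        unfolding distrib_left n using sJ[of T s "L + e * p / 4"] T s K n L e p
        by (simp add: ennreal_mult)
      also have "\<dots> \<le> ennreal (e / 2) + ennreal ((L + e * p / 4) * (2 / p) * 1)"
      proof (intro add_mono ennreal_leI mult_left_mono)
        show "T powr (- (s * p / 2)) \<le> 1"
          using T s p powr_mono[of "- (s * p / 2)" 0 T] by simp
      qed (use elim L e p in auto)
      also have "\<dots> = ennreal (2 / p * L + e)"
        using e p L by (subst ennreal_plus[symmetric]) (auto simp: field_simps)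
      finally show ?case .
    qed
  }
  {
    fix e :: real assume e: "0 < e"
    show "eventually (\<lambda>s. ennreal (2 / p * L - e) \<le> ennreal s * ?N s) (at_right 0)"
    proof (cases "0 < L - e * p / 4")
      case False
      moreover have "0 < e * p" using p e by simp
      ultimately have "2 / p * L - e \<le> 0" using p by (simp add: field_simps)
      then show ?thesis by (simp add: ennreal_neg)
    next
      case b: True
      have "ennreal (L - e * p / 4) < ennreal L" using e p b by (simp add: ennreal_less_iff)
      from order_tendstoD(1)[OF lim this]
      obtain T0 where T0: "\<And>t. T0 \<le> t \<Longrightarrow> ennreal (L - e * p / 4) < A t"
        unfolding eventually_at_top_linorder by auto
      define T where "T = max T0 1"
      have T: "1 \<le> T" "\<And>t. T \<le> t \<Longrightarrow> ennreal (L - e * p / 4) \<le> A t"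
        using T0 by (auto simp: T_def less_imp_le)
      have "((\<lambda>s. (L - e * p / 4) * (2 / p) * T powr (- (s * p / 2)))
          \<longlongrightarrow> (L - e * p / 4) * (2 / p) * T powr (- (0 * p / 2))) (at_right 0)"
        using T by (intro tendsto_intros) auto
      moreover have "2 / p * L - e < (L - e * p / 4) * (2 / p) * T powr (- (0 * p / 2))"
        using e p T by (simp add: field_simps)
      ultimately have "eventually (\<lambda>s. 2 / p * L - e < (L - e * p / 4) * (2 / p) * T powr (- (s * p / 2))) (at_right 0)"
        by (rule order_tendstoD(1))
      with pos show ?thesis
      proof eventually_elim
        case (elim s)
        then have s: "0 < s" by auto
        have "ennreal (2 / p * L - e) \<le> ennreal s * (ennreal (L - e * p / 4) * ?J T s)"
          using elim sJ[of T s "L - e * p / 4"] T s b by (simp add: ennreal_leI)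
        also have "ennreal (L - e * p / 4) * ?J T s
            = (\<integral>\<^sup>+ t. ennreal (L - e * p / 4) * (ennreal (t powr (- (1 + s * p / 2))) * indicator {T..} t) \<partial>lborel)"
          by (simp add: nn_integral_cmult)
        also have "\<dots> \<le> ?N s"
        proof (intro nn_integral_mono)
          fix t :: real
          show "ennreal (L - e * p / 4) * (ennreal (t powr (- (1 + s * p / 2))) * indicator {T..} t)
            \<le> ennreal (t powr (- (1 + s * p / 2))) * A t * indicator {0<..} t"
            using T mult_left_mono[OF T(2)[of t], of "ennreal (t powr (- (1 + s * p / 2)))"]
            by (auto simp: indicator_def mult.commute)
        qed
        finally show ?case by (simp add: mult_left_mono)
      qed
    qed
  }
qed

lemma local_max_second_deriv_le:
  fixes g :: "real \<Rightarrow> real"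
  assumes r: "0 < r"
    and max: "\<And>h. \<bar>h\<bar> < r \<Longrightarrow> g h \<le> g 0"
    and g: "\<And>h. (g has_real_derivative g' h) (at h)"
    and g': "(g' has_real_derivative c) (at 0)"
  shows "c \<le> 0"
proof -
  have 0: "g' 0 = 0"
    using DERIV_local_max[OF g r] max by auto
  show "c \<le> 0"
  proof (rule ccontr)
    assume "\<not> c \<le> 0"
    then obtain d where d: "0 < d" "\<And>h. 0 < h \<Longrightarrow> h < d \<Longrightarrow> 0 < g' h"
      using DERIV_pos_inc_right[OF g'] 0 by auto
    define k where "k = min d r / 2"
    have k: "0 < k" "k < d" "k < r" using d r by (auto simp: k_def min_def)
    have "g 0 < g k"
    proof (rule DERIV_pos_imp_increasing_open[OF k(1)])
      show "\<exists>y. DERIV g x :> y \<and> 0 < y" if "0 < x" "x < k" for x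
        using g[of x] d(2)[of x] that k by auto
      show "continuous_on {0..k} g" using g by (meson DERIV_isCont continuous_at_imp_continuous_on)
    qed
    then show False using max[of k] k by auto
  qed
qed

lemma DERIV_frechet_line:
  fixes f :: "'a::euclidean_space \<Rightarrow> real"
  assumes "f differentiable (at (x + h *\<^sub>R b))"
  shows "((\<lambda>h. f (x + h *\<^sub>R b)) has_real_derivative frechet_derivative f (at (x + h *\<^sub>R b)) b) (at h)"
proof -
  let ?D = "frechet_derivative f (at (x + h *\<^sub>R b))"
  have D: "(f has_derivative ?D) (at (x + h *\<^sub>R b))"
    using assms by (simp add: frechet_derivative_works)
  have "((\<lambda>h. x + h *\<^sub>R b) has_derivative (\<lambda>k. k *\<^sub>R b)) (at h)"
    by (auto intro!: derivative_eq_intros)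
  from diff_chain_at[OF this D]
  have "((\<lambda>h. f (x + h *\<^sub>R b)) has_derivative (\<lambda>k. ?D (k *\<^sub>R b))) (at h)"
    by (simp add: o_def)
  moreover have "(\<lambda>k. ?D (k *\<^sub>R b)) = (*) (?D b)"
    using linear_scale[OF has_derivative_linear[OF D]] by (auto simp: mult.commute)
  ultimately show ?thesis by (simp add: has_field_derivative_def)
qed

lemma DERIV_gaussian_line:
  fixes x b \<xi> :: "'a::euclidean_space"
  assumes "\<tau> > 0"
  shows "((\<lambda>h. c * exp (- ((x + h *\<^sub>R b) \<bullet> (x + h *\<^sub>R b)) / (4 * \<tau>))
           + \<epsilon> * ((x + h *\<^sub>R b) \<bullet> (x + h *\<^sub>R b)) - \<xi> \<bullet> (x + h *\<^sub>R b))
      has_real_derivative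
        (2 * \<epsilon> - c * exp (- ((x + h *\<^sub>R b) \<bullet> (x + h *\<^sub>R b)) / (4 * \<tau>)) / (2 * \<tau>)) * (x \<bullet> b + h * (b \<bullet> b)) - \<xi> \<bullet> b) (at h)"
    (is ?first)
   and "((\<lambda>h. (2 * \<epsilon> - c * exp (- ((x + h *\<^sub>R b) \<bullet> (x + h *\<^sub>R b)) / (4 * \<tau>)) / (2 * \<tau>)) * (x \<bullet> b + h * (b \<bullet> b)) - \<xi> \<bullet> b)
      has_real_derivative
        (2 * \<epsilon> - c * exp (- (x \<bullet> x) / (4 * \<tau>)) / (2 * \<tau>)) * (b \<bullet> b) + c * exp (- (x \<bullet> x) / (4 * \<tau>)) * (x \<bullet> b)\<^sup>2 / (4 * \<tau>\<^sup>2)) (at 0)"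
    (is ?second)
proof -
  have q: "(x + h *\<^sub>R b) \<bullet> (x + h *\<^sub>R b) = x \<bullet> x + 2 * h * (x \<bullet> b) + h * h * (b \<bullet> b)"
    "\<xi> \<bullet> (x + h *\<^sub>R b) = \<xi> \<bullet> x + h * (\<xi> \<bullet> b)" for h
    by (simp_all add: inner_add_left inner_add_right inner_commute)
  show ?first unfolding q
    by (rule derivative_eq_intros refl | (use assms in simp; fail))+ (use assms in \<open>simp add: field_simps\<close>)
  show ?second unfolding q
    by (rule derivative_eq_intros refl | (use assms in simp; fail))+
      (use assms in \<open>simp add: field_simps power2_eq_square\<close>)
qed

text \<open>Here \<open>f\<close> is touched from above by a time slice of the Gaussian solution of the Dunkl heat
  equation plus a quadratic term and a linear term, the latter being Dunkl harmonic.\<close>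

lemma dunkl_laplacian_le_at_max:
  fixes f :: "'a::euclidean_space \<Rightarrow> real" and Rp :: "'a set" and \<kappa> :: "'a \<Rightarrow> real"
  defines "N \<equiv> real DIM('a) / 2 + (\<Sum>\<alpha>\<in>Rp. \<kappa> \<alpha>)"
  assumes root: "\<And>\<alpha>. \<alpha> \<in> Rp \<Longrightarrow> \<alpha> \<bullet> \<alpha> = 2" and \<kappa>: "\<And>\<alpha>. \<alpha> \<in> Rp \<Longrightarrow> 0 \<le> \<kappa> \<alpha>"
    and f: "C2_fun f" and x: "norm x < \<rho>" and off: "\<And>\<alpha>. \<alpha> \<in> Rp \<Longrightarrow> \<alpha> \<bullet> x \<noteq> 0" and \<tau>: "0 < \<tau>"
    and max: "\<And>y. norm y \<le> \<rho> \<Longrightarrow>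
      f y - (c * exp (- (y \<bullet> y) / (4 * \<tau>)) + \<epsilon> * (y \<bullet> y) - \<xi> \<bullet> y)
        \<le> f x - (c * exp (- (x \<bullet> x) / (4 * \<tau>)) + \<epsilon> * (x \<bullet> x) - \<xi> \<bullet> x)"
  shows "dunkl_laplacian Rp \<kappa> f x
    \<le> c * exp (- (x \<bullet> x) / (4 * \<tau>)) * (x \<bullet> x / (4 * \<tau>\<^sup>2) - N / \<tau>) + 4 * N * \<epsilon>"
proof -
  define E where "E = c * exp (- (x \<bullet> x) / (4 * \<tau>))"
  have dif: "f differentiable (at y)" for y using f by (simp add: C2_fun_def)
  have dif2: "(\<lambda>y. frechet_derivative f (at y) b) differentiable (at y)" if "b \<in> Basis" for b y
    using f that by (simp add: C2_fun_def)
  let ?G = "\<lambda>y. c * exp (- (y \<bullet> y) / (4 * \<tau>)) + \<epsilon> * (y \<bullet> y) - \<xi> \<bullet> y"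
  let ?G' = "\<lambda>b h. (2 * \<epsilon> - c * exp (- ((x + h *\<^sub>R b) \<bullet> (x + h *\<^sub>R b)) / (4 * \<tau>)) / (2 * \<tau>)) * (x \<bullet> b + h * (b \<bullet> b)) - \<xi> \<bullet> b"
  let ?g = "\<lambda>b h. f (x + h *\<^sub>R b) - ?G (x + h *\<^sub>R b)"
  let ?g' = "\<lambda>b h. frechet_derivative f (at (x + h *\<^sub>R b)) b - ?G' b h"
  have g: "(?g b has_real_derivative ?g' b h) (at h)" for b h
    by (intro DERIV_diff DERIV_frechet_line[OF dif] DERIV_gaussian_line(1)[OF \<tau>])
  have line: "\<exists>r>0. \<forall>h. \<bar>h\<bar> < r \<longrightarrow> ?g b h \<le> ?g b 0" for b
  proof (intro exI[of _ "(\<rho> - norm x) / (norm b + 1)"] conjI allI impI)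
    show "0 < (\<rho> - norm x) / (norm b + 1)" using x by (auto intro!: divide_pos_pos add_nonneg_pos)
    fix h assume "\<bar>h\<bar> < (\<rho> - norm x) / (norm b + 1)"
    then have "\<bar>h\<bar> * (norm b + 1) < \<rho> - norm x"
      by (subst (asm) pos_less_divide_eq) (auto intro: add_nonneg_pos)
    then have "\<bar>h\<bar> * norm b \<le> \<rho> - norm x" by (simp add: distrib_left)
    then have "norm (x + h *\<^sub>R b) \<le> \<rho>"
      using norm_triangle_ineq[of x "h *\<^sub>R b"] by simp
    then show "?g b h \<le> ?g b 0" using max[of "x + h *\<^sub>R b"] by simp
  qed
  have D1: "frechet_derivative f (at x) b = (2 * \<epsilon> - E / (2 * \<tau>)) * (x \<bullet> b) - \<xi> \<bullet> b" for b
  proof -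
    obtain r where r: "0 < r" "\<And>h. \<bar>h\<bar> < r \<Longrightarrow> ?g b h \<le> ?g b 0" using line by blast
    have "?g' b 0 = 0" using DERIV_local_max[OF g[of b 0] r(1)] r(2) by simp
    then show ?thesis by (simp add: E_def)
  qed
  have D2: "frechet_derivative (\<lambda>y. frechet_derivative f (at y) b) (at x) b
      \<le> (2 * \<epsilon> - E / (2 * \<tau>)) + E * (x \<bullet> b)\<^sup>2 / (4 * \<tau>\<^sup>2)" if b: "b \<in> Basis" for b
  proof -
    obtain r where r: "0 < r" "\<And>h. \<bar>h\<bar> < r \<Longrightarrow> ?g b h \<le> ?g b 0" using line by blast
    have "(?g' b has_real_derivative frechet_derivative (\<lambda>y. frechet_derivative f (at y) b) (at (x + 0 *\<^sub>R b)) b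
       - ((2 * \<epsilon> - E / (2 * \<tau>)) * (b \<bullet> b) + E * (x \<bullet> b)\<^sup>2 / (4 * \<tau>\<^sup>2))) (at 0)"
      unfolding E_def
      by (rule DERIV_diff[OF DERIV_frechet_line DERIV_gaussian_line(2)[OF \<tau>]]) (use dif2[OF b] in simp)
    from local_max_second_deriv_le[where g = "?g b", OF r g this] show ?thesis
      using b by simp
  qed
  have lap: "(\<Sum>b\<in>Basis. frechet_derivative (\<lambda>y. frechet_derivative f (at y) b) (at x) b)
      \<le> DIM('a) * (2 * \<epsilon> - E / (2 * \<tau>)) + E * (x \<bullet> x) / (4 * \<tau>\<^sup>2)"
  proof -
    have "(\<Sum>b\<in>Basis. frechet_derivative (\<lambda>y. frechet_derivative f (at y) b) (at x) b)
        \<le> (\<Sum>b\<in>Basis. (2 * \<epsilon> - E / (2 * \<tau>)) + E * (x \<bullet> b)\<^sup>2 / (4 * \<tau>\<^sup>2))"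
      by (intro sum_mono D2)
    also have "\<dots> = DIM('a) * (2 * \<epsilon> - E / (2 * \<tau>)) + E * (\<Sum>b\<in>Basis. (x \<bullet> b)\<^sup>2) / (4 * \<tau>\<^sup>2)"
      by (simp add: sum.distrib sum_distrib_left sum_divide_distrib)
    also have "(\<Sum>b\<in>Basis. (x \<bullet> b)\<^sup>2) = x \<bullet> x"
      by (simp add: euclidean_inner[of x x] power2_eq_square)
    finally show ?thesis .
  qed
  have refl_term: "\<kappa> \<alpha> * (frechet_derivative f (at x) \<alpha> / (\<alpha> \<bullet> x) - (f x - f (reflection \<alpha> x)) / (\<alpha> \<bullet> x)\<^sup>2)
      \<le> \<kappa> \<alpha> * (2 * \<epsilon> - E / (2 * \<tau>))" if \<alpha>: "\<alpha> \<in> Rp" for \<alpha>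
  proof (rule mult_left_mono[OF _ \<kappa>[OF \<alpha>]])
    let ?s = "\<alpha> \<bullet> x"
    have s: "?s \<noteq> 0" using off \<alpha> .
    have rx: "reflection \<alpha> x = x - ?s *\<^sub>R \<alpha>" using root[OF \<alpha>] by (simp add: reflection_def)
    have nrx: "reflection \<alpha> x \<bullet> reflection \<alpha> x = x \<bullet> x"
      unfolding rx using root[OF \<alpha>] by (simp add: inner_diff_left inner_diff_right inner_commute)
    then have "norm (reflection \<alpha> x) \<le> \<rho>" using x by (simp add: norm_eq_sqrt_inner)
    from max[OF this] have "f x - f (reflection \<alpha> x) \<ge> \<xi> \<bullet> reflection \<alpha> x - \<xi> \<bullet> x"
      unfolding nrx by simp
    also have "\<xi> \<bullet> reflection \<alpha> x - \<xi> \<bullet> x = - ?s * (\<xi> \<bullet> \<alpha>)"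
      unfolding rx by (simp add: inner_diff_right)
    finally have "- ?s * (\<xi> \<bullet> \<alpha>) / ?s\<^sup>2 \<le> (f x - f (reflection \<alpha> x)) / ?s\<^sup>2"
      by (rule divide_right_mono) simp
    then have "- (\<xi> \<bullet> \<alpha>) / ?s \<le> (f x - f (reflection \<alpha> x)) / ?s\<^sup>2"
      using s by (simp add: power2_eq_square)
    moreover have "frechet_derivative f (at x) \<alpha> / ?s = (2 * \<epsilon> - E / (2 * \<tau>)) - (\<xi> \<bullet> \<alpha>) / ?s"
      unfolding D1 using s by (simp add: diff_divide_distrib inner_commute)
    ultimately show "frechet_derivative f (at x) \<alpha> / ?s - (f x - f (reflection \<alpha> x)) / ?s\<^sup>2
        \<le> 2 * \<epsilon> - E / (2 * \<tau>)" by simp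
  qed
  have "dunkl_laplacian Rp \<kappa> f x \<le> DIM('a) * (2 * \<epsilon> - E / (2 * \<tau>)) + E * (x \<bullet> x) / (4 * \<tau>\<^sup>2)
      + 2 * (\<Sum>\<alpha>\<in>Rp. \<kappa> \<alpha> * (2 * \<epsilon> - E / (2 * \<tau>)))"
    unfolding dunkl_laplacian_def by (intro add_mono lap mult_left_mono sum_mono refl_term) auto
  also have "\<dots> = E * (x \<bullet> x / (4 * \<tau>\<^sup>2) - N / \<tau>) + 4 * N * \<epsilon>"
    unfolding N_def sum_distrib_right[symmetric] using \<tau> by (simp add: field_simps)
  finally show ?thesis by (simp add: E_def)
qed

lemma dunkl_heat_le_gaussian:
  fixes Rp :: "'a::euclidean_space set" and u :: "real \<Rightarrow> 'a \<Rightarrow> real" and \<phi> :: "'a \<Rightarrow> real" and \<kappa> :: "'a \<Rightarrow> real"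
  defines "N \<equiv> real DIM('a) / 2 + (\<Sum>\<alpha>\<in>Rp. \<kappa> \<alpha>)"
  assumes fin: "finite Rp" and root: "\<And>\<alpha>. \<alpha> \<in> Rp \<Longrightarrow> \<alpha> \<bullet> \<alpha> = 2" and \<kappa>: "\<And>\<alpha>. \<alpha> \<in> Rp \<Longrightarrow> 0 \<le> \<kappa> \<alpha>"
    and cont: "continuous_on ({0<..} \<times> UNIV) (\<lambda>(t, x). u t x)"
    and C2: "\<And>t. 0 < t \<Longrightarrow> C2_fun (u t)"
    and heat: "\<And>t x. 0 < t \<Longrightarrow> (\<And>\<alpha>. \<alpha> \<in> Rp \<Longrightarrow> \<alpha> \<bullet> x \<noteq> 0) \<Longrightarrow>
      ((\<lambda>s. u s x) has_real_derivative dunkl_laplacian Rp \<kappa> (u t) x) (at t)"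
    and le1: "\<And>t x. 0 < t \<Longrightarrow> u t x \<le> 1"
    and lim: "uniform_limit UNIV u \<phi> (at_right 0)"
    and \<phi>1: "\<And>x. \<phi> x \<le> 1" and \<phi>0: "\<And>x. r < norm x \<Longrightarrow> \<phi> x \<le> 0"
    and t1: "0 < t1"
  shows "u t1 x1 \<le> 2 powr N * exp (r\<^sup>2 / 4) * (1 + t1) powr (- N) * exp (- (x1 \<bullet> x1) / (4 * (1 + t1)))"
proof (rule ccontr)
  define C where "C = 2 powr N * exp (r\<^sup>2 / 4)"
  define V where "V = (\<lambda>t x :: 'a. C * (1 + t) powr (- N) * exp (- (x \<bullet> x) / (4 * (1 + t))))"
  define \<Psi> where "\<Psi> = (\<lambda>x. \<Sum>\<alpha>\<in>Rp. \<bar>\<alpha> \<bullet> x\<bar>)"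
  assume "\<not> ?thesis"
  then have gap: "0 < u t1 x1 - V t1 x1" by (simp add: V_def C_def)
  have N: "0 < N" unfolding N_def by (intro add_pos_nonneg sum_nonneg \<kappa>) auto
  have V_pos: "0 < V t x" if "0 \<le> t" for t x using that by (simp add: V_def C_def)
  have V_init: "\<phi> x \<le> V t x" if "0 \<le> t" "t \<le> 1" for t x
  proof (cases "norm x \<le> r")
    case True
    then have "x \<bullet> x \<le> r\<^sup>2"
      by (metis norm_ge_zero power2_norm_eq_inner power_mono)
    moreover have "r\<^sup>2 \<le> r\<^sup>2 * (1 + t)" using that by (simp add: distrib_left)
    ultimately have "x \<bullet> x \<le> r\<^sup>2 * (1 + t)" by linarith
    then have "x \<bullet> x / (1 + t) \<le> r\<^sup>2" using that by (simp add: pos_divide_le_eq)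
    then have "x \<bullet> x / (1 + t) / 4 \<le> r\<^sup>2 / 4" by (rule divide_right_mono) simp
    then have "x \<bullet> x / (4 * (1 + t)) \<le> r\<^sup>2 / 4" by (simp only: divide_divide_eq_left mult.commute)
    then have "exp (- (r\<^sup>2 / 4)) \<le> exp (- (x \<bullet> x) / (4 * (1 + t)))" by simp
    moreover have "2 powr (- N) \<le> (1 + t) powr (- N)"
      using that N by (intro powr_mono2') auto
    ultimately have "2 powr (- N) * exp (- (r\<^sup>2 / 4)) \<le> (1 + t) powr (- N) * exp (- (x \<bullet> x) / (4 * (1 + t)))"
      by (intro mult_mono) auto
    then have "C * (2 powr (- N) * exp (- (r\<^sup>2 / 4))) \<le> V t x"
      unfolding V_def mult.assoc by (intro mult_left_mono) (auto simp: C_def)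
    moreover have "C * (2 powr (- N) * exp (- (r\<^sup>2 / 4))) = 1"
      by (simp add: C_def powr_minus exp_minus field_simps)
    ultimately show ?thesis using \<phi>1[of x] by linarith
  next
    case False
    then show ?thesis using \<phi>0[of x] V_pos[of t x] that by linarith
  qed
  define D where "D = 1 + x1 \<bullet> x1 + (4 * N + 1) * t1"
  define \<epsilon> where "\<epsilon> = (u t1 x1 - V t1 x1) / (2 * D)"
  have D: "0 < D" unfolding D_def using N t1 by (intro add_pos_pos add_pos_nonneg) auto
  have \<epsilon>: "0 < \<epsilon>" "\<epsilon> * (1 + x1 \<bullet> x1 + (4 * N + 1) * t1) = (u t1 x1 - V t1 x1) / 2"
    unfolding D_def[symmetric] using gap D by (auto simp: \<epsilon>_def)
  define K where "K = 1 + (\<Sum>\<alpha>\<in>Rp. norm \<alpha>)"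
  have K: "0 < K" unfolding K_def by (intro add_pos_nonneg sum_nonneg) auto
  define \<delta> where "\<delta> = \<epsilon> / K"
  have \<delta>: "0 < \<delta>" using \<epsilon> K by (simp add: \<delta>_def)
  have \<Psi>0: "0 \<le> \<Psi> x" for x unfolding \<Psi>_def by (intro sum_nonneg) auto
  have \<Psi>_le: "\<delta> * \<Psi> x \<le> \<epsilon> * (1 + x \<bullet> x) / 2" for x
  proof -
    have "\<Psi> x \<le> (\<Sum>\<alpha>\<in>Rp. norm \<alpha> * norm x)" unfolding \<Psi>_def by (intro sum_mono Cauchy_Schwarz_ineq2)
    also have "\<dots> \<le> K * norm x" by (simp add: K_def distrib_right sum_distrib_right)
    finally have "\<delta> * \<Psi> x \<le> \<delta> * (K * norm x)" using \<delta> by (intro mult_left_mono) auto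
    also have "\<dots> = \<epsilon> * norm x" using K by (simp add: \<delta>_def)
    also have "\<dots> \<le> \<epsilon> * ((1 + x \<bullet> x) / 2)"
    proof (intro mult_left_mono)
      have "0 \<le> (norm x - 1)\<^sup>2" by simp
      then show "norm x \<le> (1 + x \<bullet> x) / 2"
        by (simp add: power2_diff flip: power2_norm_eq_inner)
    qed (use \<epsilon> in auto)
    finally show ?thesis by simp
  qed
  define B where "B = (\<lambda>t x. \<epsilon> * (1 + x \<bullet> x + (4 * N + 1) * t) - \<delta> * \<Psi> x)"
  have B_ge: "\<epsilon> * (1 + x \<bullet> x) / 2 \<le> B t x" if "0 \<le> t" for t x
  proof -
    have "0 \<le> \<epsilon> * ((4 * N + 1) * t)" using \<epsilon> N that by auto
    then show ?thesis using \<Psi>_le[of x] by (simp add: B_def distrib_left)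
  qed
  define w where "w = (\<lambda>t x. u t x - V t x - B t x)"
  have w1: "0 < w t1 x1"
    using gap \<epsilon>(2) mult_nonneg_nonneg[OF less_imp_le[OF \<delta>] \<Psi>0[of x1]] by (simp add: w_def B_def)
  define \<rho> where "\<rho> = norm x1 + 2 / \<epsilon> + 1"
  have \<rho>: "1 \<le> \<rho>" "2 / \<epsilon> \<le> \<rho>" "norm x1 < \<rho>" using \<epsilon> by (simp_all add: \<rho>_def add_nonneg_pos)
  have w_bd: "w t x \<le> 0" if "0 < t" "\<rho> \<le> norm x" for t x
  proof -
    have "2 / \<epsilon> \<le> norm x" "1 \<le> norm x" using that \<rho> by auto
    then have "2 / \<epsilon> \<le> norm x * norm x" using mult_mono[of 1 "norm x" "2 / \<epsilon>" "norm x"] \<epsilon> by simp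
    then have "2 \<le> \<epsilon> * (x \<bullet> x)" using \<epsilon>
      by (simp add: field_simps flip: power2_norm_eq_inner) (simp add: power2_eq_square)
    then have "1 \<le> \<epsilon> * (1 + x \<bullet> x) / 2" using \<epsilon> by (simp add: distrib_left)
    then show ?thesis using B_ge[of t x] le1[of t x] V_pos[of t x] that unfolding w_def by linarith
  qed
  have "eventually (\<lambda>t. \<forall>x\<in>UNIV. dist (u t x) (\<phi> x) < \<epsilon> / 2) (at_right 0)"
    using uniform_limitD[OF lim, of "\<epsilon> / 2"] \<epsilon>(1) by simp
  then obtain b where b: "0 < b" "\<And>t x. 0 < t \<Longrightarrow> t < b \<Longrightarrow> dist (u t x) (\<phi> x) < \<epsilon> / 2"
    unfolding eventually_at_right_field by auto
  define \<tau> where "\<tau> = min (min b 1) t1 / 2"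
  have \<tau>: "0 < \<tau>" "\<tau> < b" "\<tau> < 1" "\<tau> < t1" using b t1 by (auto simp: \<tau>_def min_def)
  have w_init: "w \<tau> x \<le> 0" for x
  proof -
    have "u \<tau> x < \<phi> x + \<epsilon> / 2" using b(2)[OF \<tau>(1,2), of x] unfolding dist_real_def by linarith
    moreover have "\<epsilon> / 2 \<le> \<epsilon> * (1 + x \<bullet> x) / 2" using \<epsilon> by (simp add: distrib_left)
    ultimately show ?thesis using V_init[of \<tau> x] B_ge[of \<tau> x] \<tau> unfolding w_def by linarith
  qed
  have "continuous_on ({\<tau>..t1} \<times> cball 0 \<rho>) (\<lambda>(t, x). w t x)"
  proof -
    have "continuous_on ({\<tau>..t1} \<times> cball 0 \<rho>) (\<lambda>(t, x). u t x)"
      by (rule continuous_on_subset[OF cont]) (use \<tau> in auto)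
    then have u: "continuous_on ({\<tau>..t1} \<times> cball 0 \<rho>) (\<lambda>z. u (fst z) (snd z))"
      by (simp add: case_prod_unfold)
    show ?thesis
      unfolding w_def V_def B_def \<Psi>_def case_prod_unfold
      by (intro continuous_intros u) (use \<tau> in auto)
  qed
  from continuous_attains_sup[OF _ _ this] obtain t0 x0
    where z: "t0 \<in> {\<tau>..t1}" "norm x0 \<le> \<rho>"
      and w_max: "\<And>t x. t \<in> {\<tau>..t1} \<Longrightarrow> norm x \<le> \<rho> \<Longrightarrow> w t x \<le> w t0 x0"
    using \<tau> \<rho> by (auto simp: compact_Times)
  have w0: "0 < w t0 x0" using w_max[of t1 x1] w1 \<tau> \<rho> by auto
  have t0: "0 < t0" "\<tau> < t0" using w_init[of x0] w0 z \<tau> by (cases "t0 = \<tau>"; auto)+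
  have x0: "norm x0 < \<rho>" using w_bd[of t0 x0] w0 t0 by (meson not_le)
  define \<xi> where "\<xi> = (\<Sum>\<alpha>\<in>Rp. sgn (\<alpha> \<bullet> x0) *\<^sub>R \<alpha>)"
  have sgn_le: "sgn (\<alpha> \<bullet> x0) * (\<alpha> \<bullet> y) \<le> \<bar>\<alpha> \<bullet> y\<bar>" for \<alpha> y :: 'a
    by (cases "\<alpha> \<bullet> x0" "0 :: real" rule: linorder_cases) auto
  have \<xi>: "\<xi> \<bullet> y = (\<Sum>\<alpha>\<in>Rp. sgn (\<alpha> \<bullet> x0) * (\<alpha> \<bullet> y))" for y
    by (simp add: \<xi>_def inner_sum_left)
  have \<Psi>x0: "\<Psi> x0 = \<xi> \<bullet> x0"
    unfolding \<xi> \<Psi>_def by (simp add: abs_sgn mult.commute)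
  have \<Psi>_sub: "\<xi> \<bullet> y \<le> \<Psi> y" for y
    unfolding \<xi> \<Psi>_def by (intro sum_mono sgn_le)
  define c where "c = C * (1 + t0) powr (- N)"
  let ?G = "\<lambda>y. c * exp (- (y \<bullet> y) / (4 * (1 + t0))) + \<epsilon> * (y \<bullet> y) - (\<delta> *\<^sub>R \<xi>) \<bullet> y"
  have max: "u t0 y - ?G y + \<delta> * (\<Psi> y - \<xi> \<bullet> y) \<le> u t0 x0 - ?G x0" if "norm y \<le> \<rho>" for y
    using w_max[of t0 y] that z unfolding w_def V_def B_def \<Psi>x0 c_def
    by (simp add: algebra_simps)
  have max': "u t0 y - ?G y \<le> u t0 x0 - ?G x0" if "norm y \<le> \<rho>" for y
  proof -
    have "0 \<le> \<delta> * (\<Psi> y - \<xi> \<bullet> y)" using \<delta> \<Psi>_sub[of y] by simp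
    then show ?thesis using max[OF that] by linarith
  qed
  have dif: "u t0 differentiable (at y)" for y using C2[OF t0(1)] by (simp add: C2_fun_def)
  have off: "\<alpha> \<bullet> x0 \<noteq> 0" if \<alpha>: "\<alpha> \<in> Rp" for \<alpha>
  proof
    assume 0: "\<alpha> \<bullet> x0 = 0"
    define k where "k = (\<lambda>h. u t0 (x0 + h *\<^sub>R \<alpha>) - ?G (x0 + h *\<^sub>R \<alpha>))"
    have "\<exists>d. (k has_real_derivative d) (at 0)" unfolding k_def
      by (rule exI, rule DERIV_diff[OF DERIV_frechet_line[OF dif] DERIV_gaussian_line(1)]) (use t0 in simp)
    then obtain d where d: "(k has_real_derivative d) (at 0)" ..
    have kink: "2 * \<bar>h\<bar> \<le> \<Psi> (x0 + h *\<^sub>R \<alpha>) - \<xi> \<bullet> (x0 + h *\<^sub>R \<alpha>)" for h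
    proof -
      let ?y = "x0 + h *\<^sub>R \<alpha>"
      have "2 * \<bar>h\<bar> = \<bar>\<alpha> \<bullet> ?y\<bar> - sgn (\<alpha> \<bullet> x0) * (\<alpha> \<bullet> ?y)"
        using 0 root[OF \<alpha>] by (simp add: inner_add_right abs_mult)
      also have "\<dots> \<le> (\<Sum>\<beta>\<in>Rp. \<bar>\<beta> \<bullet> ?y\<bar> - sgn (\<beta> \<bullet> x0) * (\<beta> \<bullet> ?y))"
        by (rule member_le_sum[OF \<alpha> _ fin]) (use sgn_le in simp)
      finally show ?thesis by (simp add: \<Psi>_def \<xi> sum_subtractf)
    qed
    define q where "q = (\<rho> - norm x0) / (norm \<alpha> + 1)"
    have q: "0 < q" using x0 by (auto simp: q_def intro!: divide_pos_pos add_nonneg_pos)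
    have kmax: "k h + \<delta> * (2 * \<bar>h\<bar>) \<le> k 0" if "\<bar>h\<bar> < q" for h
    proof -
      have "\<bar>h\<bar> * (norm \<alpha> + 1) < \<rho> - norm x0"
        using that unfolding q_def by (subst (asm) pos_less_divide_eq) (auto intro: add_nonneg_pos)
      then have "\<bar>h\<bar> * norm \<alpha> \<le> \<rho> - norm x0" by (simp add: distrib_left)
      then have "norm (x0 + h *\<^sub>R \<alpha>) \<le> \<rho>"
        using norm_triangle_ineq[of x0 "h *\<^sub>R \<alpha>"] by simp
      from max[OF this] have "k h + \<delta> * (\<Psi> (x0 + h *\<^sub>R \<alpha>) - \<xi> \<bullet> (x0 + h *\<^sub>R \<alpha>)) \<le> k 0"
        by (simp add: k_def)
      moreover have "\<delta> * (2 * \<bar>h\<bar>) \<le> \<delta> * (\<Psi> (x0 + h *\<^sub>R \<alpha>) - \<xi> \<bullet> (x0 + h *\<^sub>R \<alpha>))"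
        using \<delta> by (intro mult_left_mono kink) auto
      ultimately show ?thesis by linarith
    qed
    have "d + s * (2 * \<delta>) = 0" if s: "s = 1 \<or> s = -1" for s
    proof (rule DERIV_local_max[OF _ q])
      show "((\<lambda>h. k h + s * (2 * \<delta>) * h) has_real_derivative d + s * (2 * \<delta>)) (at 0)"
        by (auto intro!: derivative_eq_intros d)
      show "\<forall>y. \<bar>0 - y\<bar> < q \<longrightarrow> k y + s * (2 * \<delta>) * y \<le> k 0 + s * (2 * \<delta>) * 0"
      proof (intro allI impI)
        fix y :: real assume "\<bar>0 - y\<bar> < q"
        then have "k y + \<delta> * (2 * \<bar>y\<bar>) \<le> k 0" using kmax[of y] by simp
        moreover have "s * (2 * \<delta>) * y \<le> \<delta> * (2 * \<bar>y\<bar>)"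
          using s \<delta> mult_left_mono[of y "\<bar>y\<bar>" \<delta>] mult_left_mono[of "-y" "\<bar>y\<bar>" \<delta>] by auto
        ultimately show "k y + s * (2 * \<delta>) * y \<le> k 0 + s * (2 * \<delta>) * 0" by simp
      qed
    qed
    from this[of 1] this[of "-1"] show False using \<delta> by simp
  qed
  have lap: "dunkl_laplacian Rp \<kappa> (u t0) x0
    \<le> c * exp (- (x0 \<bullet> x0) / (4 * (1 + t0))) * (x0 \<bullet> x0 / (4 * (1 + t0)\<^sup>2) - N / (1 + t0)) + 4 * N * \<epsilon>"
    unfolding N_def
    by (rule dunkl_laplacian_le_at_max[where \<rho> = \<rho> and \<xi> = "\<delta> *\<^sub>R \<xi>", OF root \<kappa> C2[OF t0(1)] x0 off _ max'])
      (use t0 in auto)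
  define l where "l = dunkl_laplacian Rp \<kappa> (u t0) x0
    - c * exp (- (x0 \<bullet> x0) / (4 * (1 + t0))) * (x0 \<bullet> x0 / (4 * (1 + t0)\<^sup>2) - N / (1 + t0)) - \<epsilon> * (4 * N + 1)"
  have "((\<lambda>t. C * (1 + t) powr (- N)) has_real_derivative C * (- N * (1 + t0) powr (- N - 1))) (at t0)"
    using t0 by (auto intro!: derivative_eq_intros)
  moreover have "C * (- N * (1 + t0) powr (- N - 1)) = - c * (N / (1 + t0))"
    using t0 by (simp add: c_def powr_diff)
  ultimately have time1: "((\<lambda>t. C * (1 + t) powr (- N)) has_real_derivative - c * (N / (1 + t0))) (at t0)"
    by (simp only:)
  have time2: "((\<lambda>t. exp (- (x0 \<bullet> x0) / (4 * (1 + t)))) has_real_derivative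
      exp (- (x0 \<bullet> x0) / (4 * (1 + t0))) * (x0 \<bullet> x0 / (4 * (1 + t0)\<^sup>2))) (at t0)"
    by (rule derivative_eq_intros refl | (use t0 in simp; fail))+
      (use t0 in \<open>simp add: divide_simps power2_eq_square\<close>, simp add: algebra_simps)
  have "((\<lambda>t. V t x0) has_real_derivative
      c * exp (- (x0 \<bullet> x0) / (4 * (1 + t0))) * (x0 \<bullet> x0 / (4 * (1 + t0)\<^sup>2) - N / (1 + t0))) (at t0)"
    unfolding V_def
    by (rule DERIV_cong[OF DERIV_mult[OF time1 time2]]) (simp add: c_def right_diff_distrib mult_ac)
  moreover have "((\<lambda>t. B t x0) has_real_derivative \<epsilon> * (4 * N + 1)) (at t0)"
    unfolding B_def by (auto intro!: derivative_eq_intros)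
  ultimately have "((\<lambda>t. w t x0) has_real_derivative l) (at t0)"
    unfolding w_def l_def by (intro DERIV_diff heat t0 off)
  moreover have "l < 0" using lap \<epsilon>(1) by (simp add: l_def algebra_simps)
  ultimately obtain d where d: "0 < d" "\<And>h. 0 < h \<Longrightarrow> h < d \<Longrightarrow> w t0 x0 < w (t0 - h) x0"
    using DERIV_neg_dec_left by blast
  define h where "h = min d (t0 - \<tau>) / 2"
  have "0 < h" "h < d" "h < t0 - \<tau>" using d t0 by (auto simp: h_def min_def)
  then show False using d(2)[of h] w_max[of "t0 - h" x0] z by auto
qed

lemma continuous_on_dunkl_weight:
  assumes "\<And>\<alpha>. \<alpha> \<in> Rp \<Longrightarrow> 0 \<le> \<kappa> \<alpha>"
  shows "continuous_on S (dunkl_weight Rp \<kappa>)"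
  unfolding dunkl_weight_def
proof (rule continuous_on_prod)
  fix \<alpha> assume "\<alpha> \<in> Rp"
  then show "continuous_on S (\<lambda>x. if \<kappa> \<alpha> = 0 then 1 else \<bar>\<alpha> \<bullet> x\<bar> powr (2 * \<kappa> \<alpha>))"
    using assms[of \<alpha>] by (cases "\<kappa> \<alpha> = 0") (auto intro!: continuous_intros continuous_on_powr')
qed

lemma dunkl_weight_nonneg: "0 \<le> dunkl_weight Rp \<kappa> x"
  unfolding dunkl_weight_def by (intro prod_nonneg) auto

lemma sets_dunkl_measure [measurable_cong, simp]: "sets (dunkl_measure Rp \<kappa>) = sets borel"
  by (simp add: dunkl_measure_def)

lemma space_dunkl_measure [simp]: "space (dunkl_measure Rp \<kappa>) = UNIV"
  by (simp add: dunkl_measure_def)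

lemma sigma_finite_dunkl_measure:
  assumes "\<And>\<alpha>. \<alpha> \<in> Rp \<Longrightarrow> 0 \<le> \<kappa> \<alpha>"
  shows "sigma_finite_measure (dunkl_measure Rp \<kappa>)"
proof -
  have "dunkl_weight Rp \<kappa> \<in> borel_measurable borel"
    by (intro borel_measurable_continuous_onI continuous_on_dunkl_weight assms)
  then show ?thesis
    unfolding dunkl_measure_def by (subst sigma_finite_measure.sigma_finite_iff_density_finite[OF sigma_finite_lborel]) auto
qed

lemma energy_near_norm:
  fixes f :: "'b \<Rightarrow> real" and k :: "'b \<Rightarrow> 'b \<Rightarrow> real" and p e C c :: real
  assumes "sigma_finite_measure M"
    and f[measurable]: "f \<in> borel_measurable M"
    and k[measurable]: "(\<lambda>(x, y). k x y) \<in> borel_measurable (M \<Otimes>\<^sub>M M)"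
    and k0: "\<And>x y. 0 \<le> k x y" and sym: "\<And>x y. k x y = k y x"
    and cons: "\<And>x. (\<integral>\<^sup>+ y. ennreal (k x y) \<partial>M) = 1"
    and B[measurable]: "B \<in> sets M"
    and small: "\<And>x. (\<integral>\<^sup>+ y. indicator B y * ennreal (k x y) \<partial>M) \<le> ennreal c"
    and e: "0 \<le> e" and C: "0 \<le> C"
    and ineq: "\<And>a b :: real. \<bar>\<bar>a - b\<bar> powr p - (\<bar>a\<bar> powr p + \<bar>b\<bar> powr p)\<bar>
        \<le> e * (\<bar>a\<bar> powr p + \<bar>b\<bar> powr p) + C * min (\<bar>a\<bar> powr p) (\<bar>b\<bar> powr p)"
  defines "A \<equiv> \<integral>\<^sup>+ x. (\<integral>\<^sup>+ y. ennreal (\<bar>f y - f x\<bar> powr p * k x y) \<partial>M) \<partial>M"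
    and "H \<equiv> \<integral>\<^sup>+ x. ennreal (\<bar>f x\<bar> powr p) \<partial>M"
    and "T \<equiv> \<integral>\<^sup>+ x. ennreal (\<bar>f x\<bar> powr p) * indicator (- B) x \<partial>M"
  shows "A \<le> ennreal (1 + e) * (2 * H) + ennreal C * (2 * T + ennreal c * H)"
    and "2 * H \<le> A + (ennreal e * (2 * H) + ennreal C * (2 * T + ennreal c * H))"
proof -
  interpret sigma_finite_measure M by fact
  interpret pair_sigma_finite M M ..
  define h where "h x = \<bar>f x\<bar> powr p" for x
  have [measurable]: "h \<in> borel_measurable M" unfolding h_def by measurable
  have h0: "0 \<le> h x" for x by (simp add: h_def)
  define I where "I g = (\<integral>\<^sup>+ x. (\<integral>\<^sup>+ y. g x y * ennreal (k x y) \<partial>M) \<partial>M)" for g :: "'b \<Rightarrow> 'b \<Rightarrow> ennreal"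
  have I_add: "I (\<lambda>x y. g x y + g' x y) = I g + I g'"
    if [measurable]: "(\<lambda>(x, y). g x y) \<in> borel_measurable (M \<Otimes>\<^sub>M M)" "(\<lambda>(x, y). g' x y) \<in> borel_measurable (M \<Otimes>\<^sub>M M)" for g g'
    unfolding I_def by (simp add: distrib_right nn_integral_add cong: nn_integral_cong)
  have I_cmult: "I (\<lambda>x y. a * g x y) = a * I g"
    if [measurable]: "(\<lambda>(x, y). g x y) \<in> borel_measurable (M \<Otimes>\<^sub>M M)" for g a
    unfolding I_def by (simp add: mult.assoc nn_integral_cmult cong: nn_integral_cong)
  have I_mono: "I g \<le> I g'" if "\<And>x y. g x y \<le> g' x y" for g g'
    unfolding I_def by (intro nn_integral_mono mult_right_mono that) auto
  have I_fst: "I (\<lambda>x y. g x) = (\<integral>\<^sup>+ x. g x \<partial>M)" if [measurable]: "g \<in> borel_measurable M" for g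
    unfolding I_def by (simp add: nn_integral_cmult cons cong: nn_integral_cong)
  have I_snd: "I (\<lambda>x y. g y) = (\<integral>\<^sup>+ x. g x \<partial>M)" if [measurable]: "g \<in> borel_measurable M" for g
  proof -
    have "I (\<lambda>x y. g y) = (\<integral>\<^sup>+ y. (\<integral>\<^sup>+ x. g y * ennreal (k x y) \<partial>M) \<partial>M)"
      unfolding I_def by (rule Fubini'[symmetric]) measurable
    also have "\<dots> = I (\<lambda>x y. g x)" unfolding I_def by (simp add: sym)
    finally show ?thesis by (simp add: I_fst)
  qed
  let ?m = "\<lambda>x y. min (ennreal (h x)) (ennreal (h y))"
  let ?F = "\<lambda>x y. ennreal (\<bar>f y - f x\<bar> powr p)"
  have A: "A = I ?F" unfolding A_def I_def by (simp add: ennreal_mult' k0 ennreal_mult)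
  have H: "I (\<lambda>x y. ennreal (h x) + ennreal (h y)) = 2 * H"
    by (simp add: I_add I_fst I_snd H_def h_def mult_2)
  have "I ?m \<le> I (\<lambda>x y. (ennreal (h x) * indicator (- B) x + ennreal (h y) * indicator (- B) y)
      + ennreal (h x) * indicator B y)"
    by (intro I_mono) (auto simp: indicator_def min_def not_le intro!: add_increasing)
  also have "\<dots> = 2 * T + I (\<lambda>x y. ennreal (h x) * indicator B y)"
    by (simp add: I_add I_fst I_snd T_def h_def mult_2)
  also have "I (\<lambda>x y. ennreal (h x) * indicator B y)
      = (\<integral>\<^sup>+ x. ennreal (h x) * (\<integral>\<^sup>+ y. indicator B y * ennreal (k x y) \<partial>M) \<partial>M)"
    unfolding I_def by (simp add: nn_integral_cmult mult.assoc cong: nn_integral_cong)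
  also have "\<dots> \<le> (\<integral>\<^sup>+ x. ennreal (h x) * ennreal c \<partial>M)"
    by (intro nn_integral_mono mult_left_mono small) auto
  also have "\<dots> = ennreal c * H" by (subst nn_integral_multc) (simp_all add: H_def h_def mult.commute)
  finally have m: "ennreal C * I ?m \<le> ennreal C * (2 * T + ennreal c * H)" by (simp add: mult_left_mono add_left_mono)
  have m_eq: "?m x y = ennreal (min (h x) (h y))" for x y using h0 by (auto simp: min_def ennreal_le_iff)
  have ineq': "\<bar>\<bar>f y - f x\<bar> powr p - (h y + h x)\<bar> \<le> e * (h y + h x) + C * min (h y) (h x)" for x y
    using ineq[of "f y" "f x"] by (simp add: h_def)
  have "A \<le> I (\<lambda>x y. ennreal (1 + e) * (ennreal (h x) + ennreal (h y)) + ennreal C * ?m x y)"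
    unfolding A
  proof (rule I_mono)
    fix x y
    have "\<bar>f y - f x\<bar> powr p \<le> (1 + e) * (h x + h y) + C * min (h x) (h y)"
      using ineq'[where x = x and y = y] by (simp add: algebra_simps min.commute abs_le_iff)
    then show "?F x y \<le> ennreal (1 + e) * (ennreal (h x) + ennreal (h y)) + ennreal C * ?m x y"
      unfolding m_eq using h0 e C by (simp add: ennreal_leI flip: ennreal_plus ennreal_mult)
  qed
  also have "\<dots> = ennreal (1 + e) * (2 * H) + ennreal C * I ?m"
    by (simp add: I_add I_cmult H)
  also have "\<dots> \<le> ennreal (1 + e) * (2 * H) + ennreal C * (2 * T + ennreal c * H)"
    by (intro add_left_mono m)
  finally show "A \<le> ennreal (1 + e) * (2 * H) + ennreal C * (2 * T + ennreal c * H)" .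
  have "2 * H \<le> I (\<lambda>x y. ?F x y + (ennreal e * (ennreal (h x) + ennreal (h y)) + ennreal C * ?m x y))"
    unfolding H[symmetric]
  proof (rule I_mono)
    fix x y
    have "h x + h y \<le> \<bar>f y - f x\<bar> powr p + (e * (h x + h y) + C * min (h x) (h y))"
      using ineq'[where x = x and y = y] by (simp add: algebra_simps min.commute abs_le_iff)
    then show "ennreal (h x) + ennreal (h y)
        \<le> ?F x y + (ennreal e * (ennreal (h x) + ennreal (h y)) + ennreal C * ?m x y)"
      unfolding m_eq using h0 e C by (simp add: ennreal_leI flip: ennreal_plus ennreal_mult)
  qed
  also have "\<dots> = A + (ennreal e * (2 * H) + ennreal C * I ?m)"
    by (simp add: I_add I_cmult H A)
  also have "\<dots> \<le> A + (ennreal e * (2 * H) + ennreal C * (2 * T + ennreal c * H))"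
    by (intro add_left_mono m)
  finally show "2 * H \<le> A + (ennreal e * (2 * H) + ennreal C * (2 * T + ennreal c * H))" .
qed

lemma heat_kernel_ball_decay:
  fixes Rp :: "'a::euclidean_space set" and hk :: "real \<Rightarrow> 'a \<Rightarrow> 'a \<Rightarrow> real" and r :: real and \<kappa> :: "'a \<Rightarrow> real"
  defines "N \<equiv> real DIM('a) / 2 + (\<Sum>\<alpha>\<in>Rp. \<kappa> \<alpha>)"
  assumes fin: "finite Rp" and root: "\<And>\<alpha>. \<alpha> \<in> Rp \<Longrightarrow> \<alpha> \<bullet> \<alpha> = 2" and \<kappa>: "\<And>\<alpha>. \<alpha> \<in> Rp \<Longrightarrow> 0 \<le> \<kappa> \<alpha>"
    and hk: "dunkl_heat_kernel Rp \<kappa> hk" and t: "0 < t"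
  shows "(\<integral>\<^sup>+ y. indicator (cball 0 r) y * ennreal (hk t x y) \<partial>dunkl_measure Rp \<kappa>)
    \<le> ennreal (2 powr N * exp ((r + 1)\<^sup>2 / 4) * (1 + t) powr (- N))"
proof -
  let ?M = "dunkl_measure Rp \<kappa>"
  define \<phi> where "\<phi> = (\<lambda>y :: 'a. max 0 (min 1 (r + 1 - norm y)))"
  define u where "u = (\<lambda>t x. \<integral> y. \<phi> y * hk t x y \<partial>?M)"
  have \<phi>_cont: "continuous_on S \<phi>" for S unfolding \<phi>_def by (intro continuous_intros)
  have [measurable]: "\<phi> \<in> borel_measurable borel" by (intro borel_measurable_continuous_onI \<phi>_cont)
  have \<phi>01: "0 \<le> \<phi> y" "\<phi> y \<le> 1" for y by (auto simp: \<phi>_def)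
  have \<phi>_out: "\<phi> y = 0" if "r + 1 < norm y" for y using that by (simp add: \<phi>_def)
  have hk_pos: "0 < hk t x y" if "0 < t" for t x y using hk that by (auto simp: dunkl_heat_kernel_def)
  have hk_cont: "continuous_on ({0<..} \<times> UNIV) (\<lambda>(t, x, y). hk t x y)" using hk by (simp add: dunkl_heat_kernel_def)
  have [measurable]: "hk t x \<in> borel_measurable borel" if "0 < t" for t x
    by (intro borel_measurable_continuous_onI
        continuous_on_compose2[OF hk_cont, of UNIV "\<lambda>y. (t, x, y)", simplified])
      (use that in \<open>auto intro!: continuous_intros\<close>)
  have mass: "(\<integral>\<^sup>+ y. ennreal (hk t x y) \<partial>?M) = 1" if "0 < t" for t x
    using hk that unfolding dunkl_heat_kernel_def by blast
  have int: "integrable ?M (hk t x)" "(\<integral> y. hk t x y \<partial>?M) = 1" if "0 < t" for t x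
    using that mass[OF that, of x] less_imp_le[OF hk_pos[OF that]]
    by (auto intro!: integrableI_nonneg simp: integral_eq_nn_integral)
  have int_u: "integrable ?M (\<lambda>y. \<phi> y * hk t x y)" if "0 < t" for t x
  proof (rule Bochner_Integration.integrable_bound[OF int(1)[OF that, of x]])
    show "AE y in ?M. norm (\<phi> y * hk t x y) \<le> norm (hk t x y)"
      using \<phi>01 by (auto simp: abs_mult intro!: mult_left_le_one_le)
  qed (use that in measurable)
  have le1: "u t x \<le> 1" if "0 < t" for t x
    unfolding u_def int(2)[OF that, of x, symmetric]
    using \<phi>01 less_imp_le[OF hk_pos[OF that]]
    by (intro integral_mono int_u int that) (auto intro: mult_left_le_one_le)
  have test: "continuous_on UNIV \<phi> \<and> (\<exists>r. \<forall>x. r < norm x \<longrightarrow> \<phi> x = 0)"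
    using \<phi>_cont \<phi>_out by blast
  have "uniform_limit UNIV u \<phi> (at_right 0) \<and> (\<forall>t>0. C2_fun (u t)) \<and>
      (\<forall>t>0. \<forall>x. (\<forall>\<alpha>\<in>Rp. \<alpha> \<bullet> x \<noteq> 0) \<longrightarrow>
        ((\<lambda>s. u s x) has_real_derivative dunkl_laplacian Rp \<kappa> (u t) x) (at t))"
    using hk[unfolded dunkl_heat_kernel_def, THEN conjunct2, THEN conjunct2, THEN conjunct2,
        THEN spec[of _ \<phi>], THEN mp[OF _ test]]
    unfolding u_def Let_def .
  then have sol: "uniform_limit UNIV u \<phi> (at_right 0)" "\<And>t. 0 < t \<Longrightarrow> C2_fun (u t)"
    "\<And>t x. 0 < t \<Longrightarrow> (\<And>\<alpha>. \<alpha> \<in> Rp \<Longrightarrow> \<alpha> \<bullet> x \<noteq> 0) \<Longrightarrow>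
      ((\<lambda>s. u s x) has_real_derivative dunkl_laplacian Rp \<kappa> (u t) x) (at t)"
    by simp_all
  obtain a where a: "cball 0 (r + 1) \<subseteq> cbox (- a) (a :: 'a)"
    using bounded_subset_cbox_symmetric[OF bounded_cball] by blast
  have weight[measurable]: "dunkl_weight Rp \<kappa> \<in> borel_measurable borel"
    by (intro borel_measurable_continuous_onI continuous_on_dunkl_weight \<kappa>)
  have hk_cont_y: "continuous_on S (hk t x)" if "0 < t" for S t x
    by (rule continuous_on_compose2[OF hk_cont, of S "\<lambda>y. (t, x, y)", simplified])
      (use that in \<open>auto intro!: continuous_intros\<close>)
  have u_eq: "u t x = integral (cbox (- a) a) (\<lambda>y. dunkl_weight Rp \<kappa> y * (\<phi> y * hk t x y))" if t: "0 < t" for t x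
  proof -
    let ?g = "\<lambda>y. dunkl_weight Rp \<kappa> y * (\<phi> y * hk t x y)"
    have "u t x = (\<integral> y. ?g y \<partial>lborel)"
      unfolding u_def dunkl_measure_def using t
      by (subst integral_density) (auto simp: dunkl_weight_nonneg)
    also have "\<dots> = (LINT y : cbox (- a) a | lborel. ?g y)"
      unfolding set_lebesgue_integral_def
    proof (intro Bochner_Integration.integral_cong refl)
      fix y
      show "?g y = indicator (cbox (- a) a) y *\<^sub>R ?g y"
      proof (cases "r + 1 < norm y")
        case False
        then have "y \<in> cbox (- a) a" using a by auto
        then show ?thesis by simp
      qed (simp add: \<phi>_out)
    qed
    also have "\<dots> = integral (cbox (- a) a) ?g"
      by (intro set_borel_integral_eq_integral borel_integrable_compact[folded set_integrable_def]
          continuous_intros continuous_on_dunkl_weight \<kappa> \<phi>_cont hk_cont_y t) auto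
    finally show ?thesis .
  qed
  have "continuous_on ({0<..} \<times> UNIV)
      (\<lambda>z. integral (cbox (- a) a) (\<lambda>y. dunkl_weight Rp \<kappa> y * (\<phi> y * hk (fst z) (snd z) y)))"
  proof (rule integral_continuous_on_param)
    have "continuous_on (({0<..} \<times> UNIV) \<times> cbox (- a) a) (\<lambda>z. hk (fst (fst z)) (snd (fst z)) (snd z))"
      by (rule continuous_on_compose2[OF hk_cont, of _ "\<lambda>z. (fst (fst z), snd (fst z), snd z)", simplified])
        (auto intro!: continuous_intros)
    moreover have "continuous_on (({0<..} \<times> UNIV) \<times> cbox (- a) a) (\<lambda>z :: (real \<times> 'a) \<times> 'a. dunkl_weight Rp \<kappa> (snd z))"
      by (rule continuous_on_compose2[where g = "dunkl_weight Rp \<kappa>" and t = UNIV])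
        (auto intro!: continuous_intros continuous_on_dunkl_weight \<kappa>)
    moreover have "continuous_on (({0<..} \<times> UNIV) \<times> cbox (- a) a) (\<lambda>z :: (real \<times> 'a) \<times> 'a. \<phi> (snd z))"
      by (rule continuous_on_compose2[OF \<phi>_cont[of UNIV]]) (auto intro!: continuous_intros)
    ultimately show "continuous_on (({0<..} \<times> UNIV) \<times> cbox (- a) a)
       (\<lambda>(z, y). dunkl_weight Rp \<kappa> y * (\<phi> y * hk (fst z) (snd z) y))"
      unfolding case_prod_unfold by (intro continuous_intros)
  qed
  then have u_cont: "continuous_on ({0<..} \<times> UNIV) (\<lambda>(t, x). u t x)"
    by (rule continuous_on_eq) (auto simp: u_eq)
  have "(\<integral>\<^sup>+ y. indicator (cball 0 r) y * ennreal (hk t x y) \<partial>?M) \<le> (\<integral>\<^sup>+ y. ennreal (\<phi> y * hk t x y) \<partial>?M)"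
    using \<phi>01 less_imp_le[OF hk_pos[OF t]]
    by (intro nn_integral_mono) (auto simp: indicator_def \<phi>_def)
  also have "\<dots> = ennreal (u t x)"
    unfolding u_def using \<phi>01 less_imp_le[OF hk_pos[OF t]]
    by (intro nn_integral_eq_integral int_u t) auto
  also have "u t x \<le> 2 powr N * exp ((r + 1)\<^sup>2 / 4) * (1 + t) powr (- N) * exp (- (x \<bullet> x) / (4 * (1 + t)))"
    unfolding N_def
    by (rule dunkl_heat_le_gaussian[where u = u and \<phi> = \<phi>, OF fin root \<kappa> u_cont sol(2,3) le1 sol(1) \<phi>01(2) _ t])
      (simp_all add: \<phi>_out)
  also have "\<dots> \<le> 2 powr N * exp ((r + 1)\<^sup>2 / 4) * (1 + t) powr (- N) * 1"
    using t by (intro mult_left_mono) auto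
  finally show ?thesis by (simp add: ennreal_leI)
qed

lemma heat_energy_tendsto:
  fixes Rp :: "'a::euclidean_space set" and hk :: "real \<Rightarrow> 'a \<Rightarrow> 'a \<Rightarrow> real" and f :: "'a \<Rightarrow> real"
  assumes fin: "finite Rp" and root: "\<And>\<alpha>. \<alpha> \<in> Rp \<Longrightarrow> \<alpha> \<bullet> \<alpha> = 2" and \<kappa>: "\<And>\<alpha>. \<alpha> \<in> Rp \<Longrightarrow> 0 \<le> \<kappa> \<alpha>"
    and hk: "dunkl_heat_kernel Rp \<kappa> hk" and p: "0 < p" and f: "in_Lp (dunkl_measure Rp \<kappa>) p f"
  shows "((\<lambda>t. \<integral>\<^sup>+ x. (\<integral>\<^sup>+ y. ennreal (\<bar>f y - f x\<bar> powr p * hk t x y) \<partial>dunkl_measure Rp \<kappa>) \<partial>dunkl_measure Rp \<kappa>)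
    \<longlongrightarrow> ennreal (2 * (\<integral>x. \<bar>f x\<bar> powr p \<partial>dunkl_measure Rp \<kappa>))) at_top"
    (is "(?A \<longlongrightarrow> _) _")
proof -
  let ?M = "dunkl_measure Rp \<kappa>"
  define I where "I = (\<integral>x. \<bar>f x\<bar> powr p \<partial>?M)"
  define N where "N = real DIM('a) / 2 + (\<Sum>\<alpha>\<in>Rp. \<kappa> \<alpha>)"
  have N: "0 < N" unfolding N_def by (intro add_pos_nonneg sum_nonneg \<kappa>) auto
  have [measurable]: "f \<in> borel_measurable borel"
    and int: "integrable ?M (\<lambda>x. \<bar>f x\<bar> powr p)"
    using f by (auto simp: in_Lp_def cong: measurable_cong_sets)
  have I0: "0 \<le> I" unfolding I_def by (intro integral_nonneg_AE) auto
  have H: "(\<integral>\<^sup>+ x. ennreal (\<bar>f x\<bar> powr p) \<partial>?M) = ennreal I"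
    unfolding I_def by (intro nn_integral_eq_integral int) auto
  have tail: "(\<lambda>n. \<integral>\<^sup>+ x. ennreal (\<bar>f x\<bar> powr p) * indicator (- cball 0 (real n)) x \<partial>?M) \<longlonglongrightarrow> 0"
  proof -
    have "(\<lambda>n. \<integral>\<^sup>+ x. ennreal (\<bar>f x\<bar> powr p) * indicator (- cball 0 (real n)) x \<partial>?M)
        \<longlonglongrightarrow> (\<integral>\<^sup>+ x. 0 \<partial>?M)"
    proof (rule nn_integral_dominated_convergence[where w = "\<lambda>x. ennreal (\<bar>f x\<bar> powr p)"])
      show "AE x in ?M. (\<lambda>n. ennreal (\<bar>f x\<bar> powr p) * indicator (- cball 0 (real n)) x) \<longlonglongrightarrow> 0"
      proof (intro AE_I2 tendsto_eventually)
        fix x :: 'a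
        obtain m where "norm x \<le> real m" using real_arch_simple by blast
        then show "eventually (\<lambda>n. ennreal (\<bar>f x\<bar> powr p) * indicator (- cball 0 (real n)) x = 0) sequentially"
          by (intro eventually_sequentiallyI[of m]) auto
      qed
      show "(\<integral>\<^sup>+ x. ennreal (\<bar>f x\<bar> powr p) \<partial>?M) < \<infinity>" by (simp add: H)
    qed (auto simp: indicator_def)
    then show ?thesis by simp
  qed
  {
    fix e :: real assume e: "0 < e"
    define \<eta> where "\<eta> = e / (3 * (2 * I + 1))"
    have \<eta>: "0 < \<eta>" "\<eta> * (2 * I) \<le> e / 3" using e I0 by (auto simp: \<eta>_def field_simps)
    obtain C where C: "0 \<le> C"
      "\<And>a b :: real. \<bar>\<bar>a - b\<bar> powr p - (\<bar>a\<bar> powr p + \<bar>b\<bar> powr p)\<bar>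
        \<le> \<eta> * (\<bar>a\<bar> powr p + \<bar>b\<bar> powr p) + C * min (\<bar>a\<bar> powr p) (\<bar>b\<bar> powr p)"
      using abs_diff_powr_bound[OF p \<eta>(1)] by blast
    define d where "d = e / (3 * (2 * C + 1))"
    have d: "0 < d" "C * (2 * d) \<le> e / 3" using e C by (simp_all add: d_def field_simps)
    then have "0 < ennreal d" by simp
    from order_tendstoD(2)[OF tail this]
    obtain n where n: "(\<integral>\<^sup>+ x. ennreal (\<bar>f x\<bar> powr p) * indicator (- cball 0 (real n)) x \<partial>?M)
        \<le> ennreal d" (is "?T \<le> _")
      unfolding eventually_sequentially by (meson less_imp_le order_refl)
    define c where "c = (\<lambda>t. 2 powr N * exp ((real n + 1)\<^sup>2 / 4) * (1 + t) powr (- N))"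
    have "((\<lambda>t. C * (c t * I)) \<longlongrightarrow> C * (2 powr N * exp ((real n + 1)\<^sup>2 / 4) * 0 * I)) at_top"
      unfolding c_def using N
      by (intro tendsto_intros tendsto_neg_powr filterlim_tendsto_add_at_top[OF tendsto_const filterlim_ident]) auto
    then have "((\<lambda>t. C * (c t * I)) \<longlongrightarrow> 0) at_top" by simp
    then have "eventually (\<lambda>t. C * (c t * I) < e / 3) at_top"
      by (rule order_tendstoD(2)) (use e in simp)
    then have "eventually (\<lambda>t. ?A t \<le> ennreal (2 * I + e) \<and> ennreal (2 * I - e) \<le> ?A t) at_top"
      using eventually_gt_at_top[of 0]
    proof eventually_elim
      case (elim t)
      have k[measurable]: "(\<lambda>(x, y). hk t x y) \<in> borel_measurable (borel \<Otimes>\<^sub>M borel)"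
      proof -
        have "continuous_on ({0<..} \<times> UNIV) (\<lambda>(t, x, y). hk t x y)" using hk by (simp add: dunkl_heat_kernel_def)
        then have "continuous_on UNIV (\<lambda>(x, y). hk t x y)"
          using elim continuous_on_compose2[of "{0<..} \<times> UNIV" "\<lambda>(t, x, y). hk t x y" UNIV "\<lambda>z. (t, fst z, snd z)"]
          by (simp add: continuous_intros image_subset_iff case_prod_unfold)
        then show ?thesis unfolding borel_prod by (rule borel_measurable_continuous_onI)
      qed
      have kM: "(\<lambda>(x, y). hk t x y) \<in> borel_measurable (?M \<Otimes>\<^sub>M ?M)" by measurable
      have k0: "0 \<le> hk t x y" and sym: "hk t x y = hk t y x" for x y
        using hk elim unfolding dunkl_heat_kernel_def by (auto intro: less_imp_le)
      have cons: "(\<integral>\<^sup>+ y. ennreal (hk t x y) \<partial>?M) = 1" for x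
        using hk elim unfolding dunkl_heat_kernel_def by blast
      have fM: "f \<in> borel_measurable ?M" by measurable
      have BM: "cball 0 (real n) \<in> sets ?M" by simp
      have small: "(\<integral>\<^sup>+ y. indicator (cball 0 (real n)) y * ennreal (hk t x y) \<partial>?M) \<le> ennreal (c t)" for x
        unfolding c_def N_def by (rule heat_kernel_ball_decay[OF fin root \<kappa> hk]) (use elim in auto)
      note near = energy_near_norm[OF sigma_finite_dunkl_measure[OF \<kappa>] fM kM k0 sym cons BM small
          less_imp_le[OF \<eta>(1)] C, unfolded H]
      let ?Q = "ennreal C * (2 * ?T + ennreal (c t) * ennreal I)"
      have c0: "0 \<le> c t" by (simp add: c_def)
      have "?Q \<le> ennreal C * (2 * ennreal d + ennreal (c t) * ennreal I)"
        by (intro mult_left_mono add_right_mono n) auto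
      also have "\<dots> = ennreal (C * (2 * d + c t * I))"
        using C d c0 I0 by (simp add: ennreal_mult)
      also have "\<dots> \<le> ennreal (2 * e / 3)"
      proof (rule ennreal_leI)
        show "C * (2 * d + c t * I) \<le> 2 * e / 3" using elim d by (simp add: distrib_left)
      qed
      finally have Q: "?Q \<le> ennreal (2 * e / 3)" .
      have two: "2 * ennreal I = ennreal (2 * I)" using I0 by (simp add: ennreal_mult)
      have err: "ennreal \<eta> * (2 * ennreal I) + ?Q \<le> ennreal e"
      proof -
        have "ennreal \<eta> * (2 * ennreal I) + ?Q \<le> ennreal (e / 3) + ennreal (2 * e / 3)"
          unfolding two using \<eta> I0 by (intro add_mono Q) (simp add: ennreal_leI flip: ennreal_mult)
        also have "\<dots> = ennreal e" using e by (simp flip: ennreal_plus)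
        finally show ?thesis .
      qed
      have "?A t \<le> 2 * ennreal I + (ennreal \<eta> * (2 * ennreal I) + ?Q)"
        using near(1) \<eta>(1) by (simp add: ennreal_plus distrib_right add.assoc)
      also have "\<dots> \<le> ennreal (2 * I) + ennreal e" unfolding two[symmetric] by (intro add_left_mono err)
      also have "\<dots> = ennreal (2 * I + e)" using I0 e by simp
      finally have up: "?A t \<le> ennreal (2 * I + e)" .
      have "ennreal (2 * I) \<le> ?A t + ennreal e"
        using near(2) add_left_mono[OF err, of "?A t"] unfolding two by (rule order_trans)
      then have "ennreal (2 * I - e) \<le> ?A t"
        using e by (cases "?A t") (auto simp flip: ennreal_plus simp: ennreal_le_iff intro!: ennreal_leI)
      with up show ?case ..
    qed
  }
  note close = this
  show ?thesis unfolding I_def[symmetric]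
  proof (rule tendsto_ennrealI)
    show "0 \<le> 2 * I" using I0 by simp
  qed (use close in \<open>simp_all only: eventually_conj_iff\<close>)
qed

lemma heat_energy_measurable:
  fixes Rp :: "'a::euclidean_space set" and hk :: "real \<Rightarrow> 'a \<Rightarrow> 'a \<Rightarrow> real" and f :: "'a \<Rightarrow> real"
  assumes "\<And>\<alpha>. \<alpha> \<in> Rp \<Longrightarrow> 0 \<le> \<kappa> \<alpha>"
    and cont: "continuous_on ({0<..} \<times> UNIV) (\<lambda>(t, x, y). hk t x y)"
    and f[measurable]: "f \<in> borel_measurable borel"
  shows "(\<lambda>t. (\<integral>\<^sup>+ x. (\<integral>\<^sup>+ y. ennreal (\<bar>f y - f x\<bar> powr p * hk t x y) \<partial>dunkl_measure Rp \<kappa>)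
      \<partial>dunkl_measure Rp \<kappa>) * indicator {0<..} t) \<in> borel_measurable borel"
proof -
  let ?M = "dunkl_measure Rp \<kappa>"
  interpret sigma_finite_measure ?M by (rule sigma_finite_dunkl_measure) fact
  define k where "k = (\<lambda>z. indicator ({0<..} \<times> UNIV) z *\<^sub>R (case z of (t, x, y) \<Rightarrow> hk t x y))"
  have "k \<in> borel_measurable borel" unfolding k_def
    by (rule borel_measurable_continuous_on_indicator[OF _ cont]) (auto intro!: borel_open open_Times)
  then have [measurable]: "k \<in> borel_measurable (borel \<Otimes>\<^sub>M borel \<Otimes>\<^sub>M borel)" by (simp add: borel_prod)
  have "(\<lambda>t. \<integral>\<^sup>+ x. (\<integral>\<^sup>+ y. ennreal (\<bar>f y - f x\<bar> powr p * k (t, x, y)) \<partial>?M) \<partial>?M) \<in> borel_measurable borel"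
    by measurable
  also have "(\<lambda>t. \<integral>\<^sup>+ x. (\<integral>\<^sup>+ y. ennreal (\<bar>f y - f x\<bar> powr p * k (t, x, y)) \<partial>?M) \<partial>?M)
     = (\<lambda>t. (\<integral>\<^sup>+ x. (\<integral>\<^sup>+ y. ennreal (\<bar>f y - f x\<bar> powr p * hk t x y) \<partial>?M) \<partial>?M) * indicator {0<..} t)"
    by (auto simp: k_def indicator_def fun_eq_iff)
  finally show ?thesis .
qed

theorem theorem1p2:
  fixes R Rp :: "'a::euclidean_space set"
    and \<kappa> :: "'a \<Rightarrow> real"
    and hk :: "real \<Rightarrow> 'a \<Rightarrow> 'a \<Rightarrow> real"
    and p :: real
    and f :: "'a \<Rightarrow> real"
  assumes "root_system R"
    and "positive_subsystem R Rp"
    and "multiplicity_function R \<kappa>"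
    and "dunkl_heat_kernel Rp \<kappa> hk"
    and "1 \<le> p"
    and "f \<in> (\<Union>s\<in>{0<..<1}. besov_space Rp \<kappa> hk s p)"
  shows "((\<lambda>s. ennreal s * besov_Np Rp \<kappa> hk p s f)
           \<longlongrightarrow> ennreal (4 / p * (\<integral>x. \<bar>f x\<bar> powr p \<partial>dunkl_measure Rp \<kappa>))) (at_right 0)"
proof -
  let ?I = "\<integral>x. \<bar>f x\<bar> powr p \<partial>dunkl_measure Rp \<kappa>"
  have sub: "Rp \<subseteq> R" using assms(2) by (auto simp: positive_subsystem_def)
  have fin: "finite Rp" using assms(1) sub by (auto simp: root_system_def intro: finite_subset)
  have root: "\<alpha> \<bullet> \<alpha> = 2" if "\<alpha> \<in> Rp" for \<alpha>
  proof -
    have "norm \<alpha> = sqrt 2" using assms(1) sub that by (auto simp: root_system_def)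
    then show ?thesis by (simp flip: power2_norm_eq_inner)
  qed
  have \<kappa>: "0 \<le> \<kappa> \<alpha>" if "\<alpha> \<in> Rp" for \<alpha> using assms(3) sub that by (auto simp: multiplicity_function_def)
  have p: "0 < p" using assms(5) by simp
  obtain s0 where s0: "0 < s0" and f: "in_Lp (dunkl_measure Rp \<kappa>) p f"
    and besov: "besov_Np Rp \<kappa> hk p s0 f < \<infinity>"
    using assms(6) by (auto simp: besov_space_def)
  have "f \<in> borel_measurable borel" using f by (auto simp: in_Lp_def cong: measurable_cong_sets)
  moreover have "continuous_on ({0<..} \<times> UNIV) (\<lambda>(t, x, y). hk t x y)"
    using assms(4) by (simp add: dunkl_heat_kernel_def)
  ultimately have meas: "(\<lambda>t. (\<integral>\<^sup>+ x. (\<integral>\<^sup>+ y. ennreal (\<bar>f y - f x\<bar> powr p * hk t x y) \<partial>dunkl_measure Rp \<kappa>)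
      \<partial>dunkl_measure Rp \<kappa>) * indicator {0<..} t) \<in> borel_measurable borel"
    by (intro heat_energy_measurable \<kappa>)
  have "0 \<le> 2 * ?I" by simp
  from scaled_mellin_tendsto[OF meas p s0 this besov[unfolded besov_Np_def]
      heat_energy_tendsto[OF fin root \<kappa> assms(4) p f]]
  have "((\<lambda>s. ennreal s * besov_Np Rp \<kappa> hk p s f) \<longlongrightarrow> ennreal (2 / p * (2 * ?I))) (at_right 0)"
    unfolding besov_Np_def .
  then show ?thesis by simp
qed

end
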